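(* The assignment $T\mapsto \hat{T}$, $U\mapsto u$, $X\mapsto\hat{X}$ extends (uniquely) to a representation of the double affine Hecke algebra $\mathbb{H}$ on $\mathcal{C}(\mathbb{Z})$; that is, the operators $\hat T,u,\hat X$ on $\mathcal{C}(\mathbb{Z})$ are invertible and satisfy (besides $u^2=1$) $$(\hat{T}-\tau)(\hat{T}+\tau^{-1})=0\quad\text{and}\quad u\hat{X} u = \hat{X}^{-1}=\hat{T}^{-1} \hat{X}\hat{T}^{-1}.$$
   Context: Fix $\tau\in(0,1)$ and an integer $M>1$. The double affine Hecke algebra $\mathbb{H}$ (type $A_1$, $q=1$) is the complex unital associative algebra generated by invertible elements $T,U,X$ subject to $(T-\tau)(T+\tau^{-1})=0$, $U^2=1$, $UXU=X^{-1}=T^{-1}XT^{-1}$. Affine Weyl group: $W=\langle s,u\mid s^2=u^2=1\rangle$, $s_1:=s$, $s_0:=usu$, $W_S:=\langle s_0,s_1\rangle$. Every $w\in W$ can be written uniquely as $w=u^{i_0}s_{i_1}\cdots s_{i_r}$ with $i_j\in\{0,1\}$ and $r\ge 0$ minimal; $\ell(w):=r$. Put $\eta(w):=\ell(ws)-\ell(w)\in\{1,-1\}$. For $v,w\in W$: $v<w$ iff $v^{-1}w\in W_S$ and $\ell(v)<\ell(w)$. $\mathcal{C}(\mathbb{Z})$ is the space of functions $f:\mathbb{Z}\to\mathbb{C}$, with $f_n:=f(n)$. $W$ acts on $\mathbb{Z}$ by $sn=-n$, $un=M-n$ and on $\mathcal{C}(\mathbb{Z})$ by $(wf)(n)=f(w^{-1}n)$.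 $\Lambda_M:=\{0,1,\dots,M\}$ is a fundamental domain for $W_S$ on $\mathbb{Z}$; $w_n$ denotes the unique shortest element of $W_S$ with $w_n n\in\Lambda_M$, and $n_+:=w_n n$. Convention: $\text{sign}(0)=0$. The operator $\hat T$ on $\mathcal{C}(\mathbb{Z})$ is $\hat{T}:=\tau+\tau^{\text{sign}}(s-1)$ with $(\tau^{\text{sign}}f)_n:=\tau^{\text{sign}(n)}f_n$; i.e. $(\hat Tf)_n=\tau f_{-n}$ if $n\ge0$ and $(\hat Tf)_n=\tau^{-1}f_{-n}+(\tau-\tau^{-1})f_n$ if $n<0$. The operator $\hat X$ on $\mathcal{C}(\mathbb{Z})$ is $$(\hat{X}f)_n := \tau^{(\ell (w_{n-1})-\ell (w_n))(1+\eta(w_{un}))}f_{n-1}+\text{sign}(n) \sum_{v\in W,\, v<w_n}\tau^{-(\ell (w_{n})-\ell (v))}a(\ell (w_{n})-\ell (v))\, f_{v(n-\text{sign}(n))_+},$$ where $f_{v(n-\text{sign}(n))_+}$ is the value of $f$ at the point obtained by applying $v$ to $(n-\text{sign}(n))_+$, and $a(k):=\frac{1-\tau^2}{1+\tau^2}\bigl(\tau^{-k}+(-1)^{k+1}\tau^k\bigr)$. *)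

theory Defs
  imports
    Complex_Main
    "HOL-Library.Function_Algebras"
    "HOL-Library.Poly_Mapping"
    "HOL-Algebra.Algebra"
    "HOL-Algebra.Algebraic_Closure_Type"
begin

datatype weyl_gen = Gs | Gu

inductive weyl_cancel :: "weyl_gen list \<Rightarrow> weyl_gen list \<Rightarrow> bool" where
  "weyl_cancel (xs @ [g, g] @ ys) (xs @ ys)"

text \<open>Since both generators are involutions, the monoid of words modulo
  \<open>ss = uu = 1\<close> is already the group \<open>\<langle>s, u | s\<^sup>2 = u\<^sup>2 = 1\<rangle>\<close>; the inverse of a word
  is its reversal.\<close>

quotient_type affine_weyl = "weyl_gen list" / "equivclp weyl_cancel"
  by (rule equivp_evquivclp)

lemma weyl_cancel_append:
  assumes "weyl_cancel xs ys"
  shows "weyl_cancel (as @ xs @ bs) (as @ ys @ bs)"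
  using assms
proof cases
  case (1 cs g ds)
  then show ?thesis
    using weyl_cancel.intros[of "as @ cs" g "ds @ bs"] by simp
qed

lemma equivclp_map:
  assumes "equivclp r x y" and "\<And>x y. r x y \<Longrightarrow> equivclp q (f x) (f y)"
  shows "equivclp q (f x) (f y)"
  using assms(1)
proof (induction rule: equivclp_induct)
  case base
  show ?case by simp
next
  case (step y z)
  then show ?case
    by (meson assms(2) equivclp_sym equivclp_trans)
qed

instantiation affine_weyl :: "{monoid_mult, inverse}"
begin

lift_definition one_affine_weyl :: affine_weyl is "[]" .

lift_definition times_affine_weyl :: "affine_weyl \<Rightarrow> affine_weyl \<Rightarrow> affine_weyl" is "(@)"
proof -
  fix a b c d
  assume ab: "equivclp weyl_cancel a b" and cd: "equivclp weyl_cancel c d"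
  have "equivclp weyl_cancel (a @ c) (b @ c)"
    using ab by (rule equivclp_map) (use weyl_cancel_append[of _ _ "[]" c] in auto)
  moreover have "equivclp weyl_cancel (b @ c) (b @ d)"
    using cd by (rule equivclp_map) (use weyl_cancel_append[of _ _ b "[]"] in auto)
  ultimately show "equivclp weyl_cancel (a @ c) (b @ d)"
    by (rule equivclp_trans)
qed

lift_definition inverse_affine_weyl :: "affine_weyl \<Rightarrow> affine_weyl" is rev
proof -
  fix a b
  assume "equivclp weyl_cancel a b"
  then show "equivclp weyl_cancel (rev a) (rev b)"
  proof (rule equivclp_map)
    fix x y
    assume "weyl_cancel x y"
    then show "equivclp weyl_cancel (rev x) (rev y)"
    proof cases
      case (1 cs g ds)
      then show ?thesis
        using weyl_cancel.intros[of "rev ds" g "rev cs"] by auto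
    qed
  qed
qed

definition divide_affine_weyl :: "affine_weyl \<Rightarrow> affine_weyl \<Rightarrow> affine_weyl" where
  "divide_affine_weyl v w = v * inverse w"

instance
  by standard (transfer, simp)+

end

lemma weyl_left_inverse: "inverse w * w = (1 :: affine_weyl)"
proof transfer
  fix w
  show "equivclp weyl_cancel (rev w @ w) []"
  proof (induction w)
    case (Cons g w)
    have "weyl_cancel (rev (g # w) @ g # w) (rev w @ w)"
      using weyl_cancel.intros[of "rev w" g w] by simp
    with Cons show ?case
      by (meson equivclp_trans r_into_equivclp)
  qed simp
qed

definition weyl_group :: "affine_weyl monoid" where
  "weyl_group = \<lparr>carrier = UNIV, monoid.mult = (*), one = 1\<rparr>"

lemma group_weyl_group: "group weyl_group"
  by (rule groupI) (auto simp: weyl_group_def mult.assoc intro: weyl_left_inverse)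

lemma inv_weyl_group: "inv\<^bsub>weyl_group\<^esub> w = inverse w"
  by (rule group.inv_equality[OF group_weyl_group])
     (auto simp: weyl_group_def weyl_left_inverse)

lift_definition weyl_s :: affine_weyl is "[Gs]" .

lift_definition weyl_u :: affine_weyl is "[Gu]" .

definition weyl_refl :: "nat \<Rightarrow> affine_weyl" where
  "weyl_refl i = (if i = 0 then weyl_u * weyl_s * weyl_u else weyl_s)"

definition weyl_WS :: "affine_weyl set" where
  "weyl_WS = generate weyl_group {weyl_refl 0, weyl_refl 1}"

definition weyl_length :: "affine_weyl \<Rightarrow> nat" where
  "weyl_length w =
    (LEAST r. \<exists>i js. i \<in> {0, 1::nat} \<and> set js \<subseteq> {0, 1} \<and> length js = r \<and>
       w = weyl_u ^ i * prod_list (map weyl_refl js))"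

definition weyl_eta :: "affine_weyl \<Rightarrow> int" where
  "weyl_eta w = int (weyl_length (w * weyl_s)) - int (weyl_length w)"

definition weyl_less :: "affine_weyl \<Rightarrow> affine_weyl \<Rightarrow> bool" where
  "weyl_less v w \<longleftrightarrow> inverse v * w \<in> weyl_WS \<and> weyl_length v < weyl_length w"

primrec weyl_gen_act :: "int \<Rightarrow> weyl_gen \<Rightarrow> int \<Rightarrow> int" where
  "weyl_gen_act M Gs n = - n"
| "weyl_gen_act M Gu n = M - n"

lift_definition weyl_act :: "int \<Rightarrow> affine_weyl \<Rightarrow> int \<Rightarrow> int"
  is "\<lambda>M. foldr (weyl_gen_act M)"
proof -
  fix M and a b
  assume "equivclp weyl_cancel a b"
  then show "foldr (weyl_gen_act M) a = foldr (weyl_gen_act M) b"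
  proof (induction rule: equivclp_induct)
    case (step y z)
    have eq: "foldr (weyl_gen_act M) x = foldr (weyl_gen_act M) y"
      if "weyl_cancel x y" for x y
      using that
    proof cases
      case (1 cs g ds)
      then show ?thesis
        by (cases g) (auto simp: fun_eq_iff)
    qed
    from step show ?case
      using eq by metis
  qed simp
qed

definition weyl_op :: "int \<Rightarrow> affine_weyl \<Rightarrow> (int \<Rightarrow> complex) \<Rightarrow> int \<Rightarrow> complex" where
  "weyl_op M w f = (\<lambda>n. f (weyl_act M (inverse w) n))"

definition weyl_shortest :: "int \<Rightarrow> int \<Rightarrow> affine_weyl" where
  "weyl_shortest M n =
    (THE w. is_arg_min weyl_length (\<lambda>w. w \<in> weyl_WS \<and> weyl_act M w n \<in> {0..M}) w)"

definition weyl_dom :: "int \<Rightarrow> int \<Rightarrow> int" where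
  "weyl_dom M n = weyl_act M (weyl_shortest M n) n"

definition cscale :: "complex \<Rightarrow> (int \<Rightarrow> complex) \<Rightarrow> int \<Rightarrow> complex" where
  "cscale c f = (\<lambda>n. c * f n)"

definition tau_sign :: "real \<Rightarrow> (int \<Rightarrow> complex) \<Rightarrow> int \<Rightarrow> complex" where
  "tau_sign \<tau> f = (\<lambda>n. complex_of_real \<tau> powi sgn n * f n)"

text \<open>\<open>+\<close>, \<open>-\<close> and \<open>0\<close> on functions and on operators are pointwise.\<close>

definition T_hat :: "real \<Rightarrow> int \<Rightarrow> (int \<Rightarrow> complex) \<Rightarrow> int \<Rightarrow> complex" where
  "T_hat \<tau> M f = cscale (complex_of_real \<tau>) f + tau_sign \<tau> (weyl_op M weyl_s f - f)"

definition a_coeff :: "real \<Rightarrow> int \<Rightarrow> complex" where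
  "a_coeff \<tau> k =
    (1 - complex_of_real \<tau> ^ 2) / (1 + complex_of_real \<tau> ^ 2) *
    (complex_of_real \<tau> powi (- k) + (- 1) powi (k + 1) * complex_of_real \<tau> powi k)"

text \<open>The index set of the sum is finite: there are at most two elements of each length
  in \<^const>\<open>weyl_WS\<close>.\<close>

definition X_hat :: "real \<Rightarrow> int \<Rightarrow> (int \<Rightarrow> complex) \<Rightarrow> int \<Rightarrow> complex" where
  "X_hat \<tau> M f = (\<lambda>n.
    let w = weyl_shortest M n;
        len = (\<lambda>v. int (weyl_length v))
    in complex_of_real \<tau> powi
         ((len (weyl_shortest M (n - 1)) - len w) *
          (1 + weyl_eta (weyl_shortest M (weyl_act M weyl_u n)))) * f (n - 1)
       + of_int (sgn n) *
         (\<Sum>v \<in> {v. weyl_less v w}.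
            complex_of_real \<tau> powi (- (len w - len v)) * a_coeff \<tau> (len w - len v) *
            f (weyl_act M v (weyl_dom M (n - sgn n)))))"

text \<open>The additive monoid of lists under concatenation is the free monoid, so that
  \<open>'a list \<Rightarrow>\<^sub>0 complex\<close> with its convolution product is the free unital associative
  \<open>\<complex>\<close>-algebra on \<open>'a\<close>.\<close>

instantiation list :: (type) monoid_add
begin

definition zero_list :: "'a list" where "zero_list = []"

definition plus_list :: "'a list \<Rightarrow> 'a list \<Rightarrow> 'a list" where "plus_list = (@)"

instance
  by standard (simp_all add: zero_list_def plus_list_def)

end

text \<open>\<open>GTi\<close>, \<open>GUi\<close>, \<open>GXi\<close> are the formal inverses of the generators.\<close>

datatype daha_gen = GT | GU | GX | GTi | GUi | GXi

type_synonym daha_free = "daha_gen list \<Rightarrow>\<^sub>0 complex"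

definition daha_var :: "daha_gen \<Rightarrow> daha_free" where
  "daha_var g = Poly_Mapping.single [g] 1"

definition daha_const :: "complex \<Rightarrow> daha_free" where
  "daha_const c = Poly_Mapping.single [] c"

definition daha_relators :: "real \<Rightarrow> daha_free set" where
  "daha_relators \<tau> =
    (let t = daha_var GT; u = daha_var GU; x = daha_var GX;
         t' = daha_var GTi; u' = daha_var GUi; x' = daha_var GXi
     in {t * t' - 1, t' * t - 1, u * u' - 1, u' * u - 1, x * x' - 1, x' * x - 1,
         (t - daha_const (complex_of_real \<tau>)) * (t + daha_const (inverse (complex_of_real \<tau>))),
         u ^ 2 - 1,
         u * x * u - x',
         x' - t' * x * t'})"

definition daha_ideal :: "real \<Rightarrow> daha_free set" where
  "daha_ideal \<tau> = Idl\<^bsub>ring_of_type_algebra\<^esub> (daha_relators \<tau>)"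

definition daha :: "real \<Rightarrow> daha_free set ring" where
  "daha \<tau> = ring_of_type_algebra Quot daha_ideal \<tau>"

definition daha_class :: "real \<Rightarrow> daha_free \<Rightarrow> daha_free set" where
  "daha_class \<tau> x = daha_ideal \<tau> +>\<^bsub>ring_of_type_algebra\<^esub> x"

definition End_C :: "((int \<Rightarrow> complex) \<Rightarrow> (int \<Rightarrow> complex)) ring" where
  "End_C = \<lparr>carrier = {F. Vector_Spaces.linear cscale cscale F},
            monoid.mult = (\<circ>), one = id, ring.zero = 0, add = (+)\<rparr>"

text \<open>The second condition makes the ring homomorphism \<open>\<complex>\<close>-linear: the scalar \<open>c\<close> of the
  algebra acts as multiplication by \<open>c\<close>. The functions \<open>\<rho>\<close> are taken to be \<open>undefined\<close>
  outside the algebra, so that equality of representations is equality of functions.\<close>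

definition daha_reps :: "real \<Rightarrow> (daha_free set \<Rightarrow> (int \<Rightarrow> complex) \<Rightarrow> (int \<Rightarrow> complex)) set" where
  "daha_reps \<tau> =
    {\<rho> \<in> ring_hom (daha \<tau>) End_C.
       (\<forall>c. \<rho> (daha_class \<tau> (daha_const c)) = cscale c) \<and>
       \<rho> \<in> extensional (carrier (daha \<tau>))}"

end

theory Submission
  imports Defs
begin

text \<open>Write \<open>C(k) = \<tau>\<^sup>-\<^sup>k a(k)\<close>. The orbit of \<open>p \<in> {0..M}\<close> under \<^const>\<open>weyl_WS\<close> has one
  point in each chamber, so that off the base chamber \<open>X\<close> is a weighted shift by one, corrected by a
  convolution of \<open>C\<close> with the values of \<open>f\<close> on that orbit. Since \<open>C(k + 2) = (\<tau>\<^sup>-\<^sup>2 - 1) C(k + 1) + \<tau>\<^sup>-\<^sup>2 C(k)\<close>,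
  these convolutions obey a recurrence in the chamber index. It yields, for \<open>n \<ge> 0\<close>,
  \<open>(X U T f)\<^sub>M\<^sub>+\<^sub>n = \<tau>\<^sup>-\<^sup>1 (X f)\<^sub>n\<close> and, for \<open>n < 0\<close>,
  \<open>(X U T f)\<^sub>M\<^sub>+\<^sub>n = \<tau> (X f)\<^sub>n + (\<tau>\<^sup>-\<^sup>1 - \<tau>) (X f)\<^sub>-\<^sub>n\<close>, which together say \<open>T U X U T = X\<close>.
  Conversely these two formulas determine \<open>X\<close> recursively from its values near the base chamber,
  and the relation \<open>X U X U = 1\<close> propagates along the same recursion from \<open>{0..M}\<close> to all of \<open>\<int>\<close>.\<close>

section \<open>The affine Weyl group and its chambers\<close>

lemma affine_weyl_inverse_right: "w * inverse w = (1 :: affine_weyl)"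
proof -
  have "inverse (inverse w) = w" by transfer simp
  then show ?thesis using weyl_left_inverse[of "inverse w"] by simp
qed

lemma affine_weyl_inverse_inverse [simp]: "inverse (inverse w) = (w :: affine_weyl)"
  by transfer simp

lemma affine_weyl_inverse_mult: "inverse (v * w) = inverse w * inverse (v :: affine_weyl)"
  by transfer simp

lemma affine_weyl_inverse_one [simp]: "inverse 1 = (1 :: affine_weyl)"
  by transfer simp

lemma weyl_act_one [simp]: "weyl_act M 1 n = n"
  by transfer simp

lemma weyl_act_mult [simp]: "weyl_act M (v * w) n = weyl_act M v (weyl_act M w n)"
  by transfer simp

lemma weyl_act_s [simp]: "weyl_act M weyl_s n = - n"
  by transfer simp

lemma weyl_act_u [simp]: "weyl_act M weyl_u n = M - n"
  by transfer simp

lemma weyl_act_inverse [simp]: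
  "weyl_act M (inverse w) (weyl_act M w n) = n" "weyl_act M w (weyl_act M (inverse w) n) = n"
  by (simp_all flip: weyl_act_mult add: weyl_left_inverse affine_weyl_inverse_right)

lemma weyl_act_isometry: "\<bar>weyl_act M w x - weyl_act M w y\<bar> = \<bar>x - y\<bar>"
proof transfer
  fix M x y w
  show "\<bar>foldr (weyl_gen_act M) w x - foldr (weyl_gen_act M) w y\<bar> = \<bar>x - y\<bar>"
  proof (induction w)
    case (Cons g w)
    then show ?case by (cases g) auto
  qed simp
qed

lemma weyl_s_square [simp]: "weyl_s * weyl_s = 1"
  by transfer (use weyl_cancel.intros[of "[]" Gs "[]"] in auto)

lemma weyl_u_square [simp]: "weyl_u * weyl_u = 1"
  by transfer (use weyl_cancel.intros[of "[]" Gu "[]"] in auto)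

lemma weyl_inverse_s [simp]: "inverse weyl_s = weyl_s"
  by transfer simp

lemma weyl_inverse_u [simp]: "inverse weyl_u = weyl_u"
  by transfer simp

lemma weyl_refl_square [simp]: "weyl_refl i * weyl_refl i = 1"
  by (simp add: weyl_refl_def) (metis mult.assoc mult_1_right weyl_s_square weyl_u_square)

lemma weyl_refl_square_left [simp]: "weyl_refl i * (weyl_refl i * w) = w"
  by (simp flip: mult.assoc)

lemma weyl_inverse_refl [simp]: "inverse (weyl_refl i) = weyl_refl i"
  by (simp add: weyl_refl_def affine_weyl_inverse_mult mult.assoc)

lemma weyl_act_refl: "weyl_act M (weyl_refl i) n = (if i = 0 then 2 * M - n else - n)"
  by (simp add: weyl_refl_def)

text \<open>\<open>alt_word i k\<close> is the alternating product \<open>s\<^sub>i s\<^sub>1\<^sub>-\<^sub>i s\<^sub>i \<dots>\<close> with \<open>k\<close> factors.\<close>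

fun alt_word :: "nat \<Rightarrow> nat \<Rightarrow> affine_weyl" where
  "alt_word i 0 = 1"
| "alt_word i (Suc k) = weyl_refl i * alt_word (1 - i) k"

text \<open>The new reflection either extends the alternating word or cancels its first letter; this
  closure reduces every product of reflections to an alternating one.\<close>

lemma weyl_refl_alt_word:
  assumes "i \<le> 1" "j \<le> 1"
  shows "\<exists>j' k'. j' \<le> 1 \<and> weyl_refl i * alt_word j k = alt_word j' k'"
proof (cases "k = 0 \<or> i \<noteq> j")
  case True
  then have "weyl_refl i * alt_word j k = alt_word i (Suc k)"
    using assms by (cases k) (auto simp: le_Suc_eq)
  with assms show ?thesis by blast
next
  case False
  then obtain k' where "k = Suc k'" "i = j" by (cases k) auto
  then have "weyl_refl i * alt_word j k = alt_word (1 - i) k'" by simp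
  then show ?thesis by (metis diff_le_self)
qed

lemma alt_word_eq_prod_list:
  assumes "i \<le> 1"
  shows "\<exists>js. set js \<subseteq> {0, 1} \<and> length js = k \<and> alt_word i k = prod_list (map weyl_refl js)"
  using assms
proof (induction k arbitrary: i)
  case (Suc k)
  have "1 - i \<le> 1" by simp
  then obtain js where "set js \<subseteq> {0, 1}" "length js = k"
    "alt_word (1 - i) k = prod_list (map weyl_refl js)"
    using Suc.IH by blast
  with Suc.prems show ?case
    by (intro exI[of _ "i # js"]) auto
qed simp

lemma prod_list_refl_in_WS:
  "set js \<subseteq> {0, 1} \<Longrightarrow> prod_list (map weyl_refl js) \<in> weyl_WS"
proof (induction js)
  case Nil
  then show ?case
    using generate.one[of weyl_group] by (simp add: weyl_WS_def weyl_group_def)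
next
  case (Cons j js)
  then have "weyl_refl j \<in> weyl_WS"
    by (auto simp: weyl_WS_def intro: generate.incl)
  with Cons show ?case
    using generate.eng[of "weyl_refl j" weyl_group _ "prod_list (map weyl_refl js)"]
    by (auto simp: weyl_WS_def weyl_group_def)
qed

text \<open>The generators are involutions, so the generated subgroup consists of plain products of
  reflections, and these collapse letter by letter to alternating words.\<close>

lemma weyl_WS_eq: "weyl_WS = {alt_word i k |i k. i \<le> 1}" (is "_ = ?A")
proof
  have "\<exists>i k. i \<le> 1 \<and> w = alt_word i k" if "w \<in> weyl_WS" for w
  proof -
    have "\<exists>js. set js \<subseteq> {0, 1} \<and> w = prod_list (map weyl_refl js)"
      using that unfolding weyl_WS_def
    proof (induction rule: generate.induct)
      case one
      then show ?case by (intro exI[of _ "[]"]) (simp add: weyl_group_def)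
    next
      case (incl h)
      then show ?case by (auto intro: exI[of _ "[0]"] exI[of _ "[1]"])
    next
      case (inv h)
      then show ?case
        by (auto simp: inv_weyl_group intro: exI[of _ "[0]"] exI[of _ "[1]"])
    next
      case (eng h1 h2)
      then obtain js1 js2 where "set js1 \<subseteq> {0, 1}" "h1 = prod_list (map weyl_refl js1)"
        "set js2 \<subseteq> {0, 1}" "h2 = prod_list (map weyl_refl js2)" by blast
      then show ?case
        by (intro exI[of _ "js1 @ js2"]) (simp add: weyl_group_def)
    qed
    then obtain js where "set js \<subseteq> {0, 1}" "w = prod_list (map weyl_refl js)" by blast
    then show ?thesis
    proof (induction js arbitrary: w)
      case Nil
      then show ?case by (intro exI[of _ 0]) simp
    next
      case (Cons j js)
      then obtain i k where "i \<le> 1" "prod_list (map weyl_refl js) = alt_word i k" by auto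
      with Cons.prems weyl_refl_alt_word[of j i k] show ?case by auto
    qed
  qed
  then show "weyl_WS \<subseteq> ?A" by blast
  show "?A \<subseteq> weyl_WS"
  proof
    fix w
    assume "w \<in> ?A"
    then obtain i k where "i \<le> 1" "w = alt_word i k" by blast
    with alt_word_eq_prod_list[of i k] show "w \<in> weyl_WS"
      using prod_list_refl_in_WS by metis
  qed
qed

lemma subgroup_weyl_WS: "subgroup weyl_WS weyl_group"
  unfolding weyl_WS_def
  by (rule group.generate_is_subgroup[OF group_weyl_group]) (simp add: weyl_group_def)

lemma weyl_WS_mult: "v \<in> weyl_WS \<Longrightarrow> w \<in> weyl_WS \<Longrightarrow> v * w \<in> weyl_WS"
  using subgroup.m_closed[OF subgroup_weyl_WS] by (simp add: weyl_group_def)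

lemma weyl_WS_inverse: "w \<in> weyl_WS \<Longrightarrow> inverse w \<in> weyl_WS"
  using subgroup.m_inv_closed[OF subgroup_weyl_WS] by (simp add: inv_weyl_group)

lemma alt_word_in_WS: "i \<le> 1 \<Longrightarrow> alt_word i k \<in> weyl_WS"
  by (auto simp: weyl_WS_eq)

text \<open>For \<open>M = 2\<close> the point \<open>1\<close> lies in the interior of the fundamental domain, and the length
  of an element of \<^const>\<open>weyl_WS\<close> is the number of walls between \<open>1\<close> and its image.\<close>

lemma act_2_alt_word:
  "i \<le> 1 \<Longrightarrow> weyl_act 2 (alt_word i k) 1 = (if i = 0 then 1 + 2 * int k else 1 - 2 * int k)"
  by (induction k arbitrary: i) (auto simp: weyl_act_refl le_Suc_eq)

lemma act_2_prod_list:
  "\<bar>weyl_act 2 (prod_list (map weyl_refl js)) 1 - 1\<bar> \<le> 2 * int (length js)"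
proof (induction js)
  case (Cons j js)
  then show ?case by (auto simp: weyl_act_refl)
qed simp

lemma weyl_length_WS:
  assumes "w \<in> weyl_WS"
  shows "2 * int (weyl_length w) = \<bar>weyl_act 2 w 1 - 1\<bar>"
proof -
  obtain i k where w: "i \<le> 1" "w = alt_word i k"
    using assms by (auto simp: weyl_WS_eq)
  have "weyl_length w = k"
    unfolding weyl_length_def
  proof (rule Least_equality)
    from alt_word_eq_prod_list[OF w(1), of k] w(2)
    show "\<exists>i js. i \<in> {0, 1::nat} \<and> set js \<subseteq> {0, 1} \<and> length js = k \<and>
        w = weyl_u ^ i * prod_list (map weyl_refl js)"
      by (auto intro!: exI[of _ "0::nat"])
  next
    fix r
    assume "\<exists>i js. i \<in> {0, 1::nat} \<and> set js \<subseteq> {0, 1} \<and> length js = r \<and>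
        w = weyl_u ^ i * prod_list (map weyl_refl js)"
    then obtain i' js where *: "i' \<in> {0, 1::nat}" "length js = r"
      "w = weyl_u ^ i' * prod_list (map weyl_refl js)" by blast
    \<comment> \<open>For \<open>M = 2\<close> the element \<open>u\<close> is the reflection about
      the point 1, so the prefix \<open>u^i'\<close> does not change the distance to 1 and only the
      \<open>r\<close> reflections count.\<close>
    have "\<bar>weyl_act 2 w 1 - 1\<bar> \<le> 2 * int r"
      using *(1,2) act_2_prod_list[of js] by (auto simp: *(3))
    then show "k \<le> r"
      using w act_2_alt_word[OF w(1), of k] by (auto split: if_splits)
  qed
  then show ?thesis
    using w act_2_alt_word[OF w(1), of k] by (auto split: if_splits)
qed

lemma weyl_length_alt_word: "i \<le> 1 \<Longrightarrow> weyl_length (alt_word i k) = k"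
  using weyl_length_WS[OF alt_word_in_WS[of i k]] act_2_alt_word[of i k] by (auto split: if_splits)

text \<open>Length is half the distance between 1 and its image, and the isometry
  \<open>inverse w\<close> carries the pair \<open>w 1\<close>, 1 to the pair 1,
  \<open>inverse w 1\<close>.\<close>

lemma weyl_length_inverse:
  assumes "w \<in> weyl_WS"
  shows "weyl_length (inverse w) = weyl_length w"
proof -
  have "2 * int (weyl_length (inverse w)) = \<bar>weyl_act 2 (inverse w) 1 - weyl_act 2 (inverse w) (weyl_act 2 w 1)\<bar>"
    using weyl_length_WS[OF weyl_WS_inverse[OF assms]] by simp
  also have "\<dots> = \<bar>1 - weyl_act 2 w 1\<bar>" by (rule weyl_act_isometry)
  finally show ?thesis using weyl_length_WS[OF assms] by simp
qed

text \<open>The images \<open>1 + 2 k\<close> and \<open>1 - 2 k\<close> of the interior point 1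
  already tell alternating words apart.\<close>

lemma alt_word_inj:
  assumes "i \<le> 1" "j \<le> 1" "alt_word i k = alt_word j l"
  shows "k = l \<and> (k = 0 \<or> i = j)"
proof -
  have "weyl_act 2 (alt_word i k) 1 = weyl_act 2 (alt_word j l) 1" using assms by simp
  then show ?thesis using assms(1,2) by (auto simp: act_2_alt_word split: if_splits)
qed

text \<open>Since \<open>v = w * inverse (inverse v * w)\<close>, the coset condition in the order
  amounts to membership of \<open>v\<close> in the subgroup once \<open>w\<close> lies
  there.\<close>

lemma weyl_less_iff:
  assumes "w \<in> weyl_WS"
  shows "weyl_less v w \<longleftrightarrow> v \<in> weyl_WS \<and> weyl_length v < weyl_length w"
proof -
  have "inverse v * w \<in> weyl_WS \<longleftrightarrow> v \<in> weyl_WS"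
  proof
    assume "inverse v * w \<in> weyl_WS"
    then have "w * inverse (inverse v * w) \<in> weyl_WS"
      by (rule weyl_WS_mult[OF assms weyl_WS_inverse])
    then show "v \<in> weyl_WS"
      by (metis affine_weyl_inverse_inverse affine_weyl_inverse_mult affine_weyl_inverse_right
          mult.assoc mult_1_left)
  qed (use assms in \<open>blast intro: weyl_WS_mult weyl_WS_inverse\<close>)
  then show ?thesis by (simp add: weyl_less_def)
qed

text \<open>There are two alternating words of each positive length, but both words of length 0 are
  the identity; the \<open>if\<close> keeps it from being counted twice.\<close>

lemma sum_weyl_less:
  fixes F :: "affine_weyl \<Rightarrow> 'a :: comm_monoid_add"
  assumes "w \<in> weyl_WS"
  shows "(\<Sum>v\<in>{v. weyl_less v w}. F v) =
    (\<Sum>l<weyl_length w. F (alt_word 0 l) + (if l = 0 then 0 else F (alt_word 1 l)))"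
proof -
  let ?k = "weyl_length w"
  have eq: "{v. weyl_less v w} = alt_word 0 ` {..<?k} \<union> alt_word 1 ` {1..<?k}"
  proof (rule Set.set_eqI)
    fix v
    have "v \<in> weyl_WS \<longleftrightarrow> (\<exists>l. v = alt_word 0 l) \<or> (\<exists>l. v = alt_word 1 l)"
      by (auto simp: weyl_WS_eq le_Suc_eq)
    moreover have "alt_word (Suc 0) 0 = alt_word 0 0" by simp
    ultimately show "v \<in> {v. weyl_less v w} \<longleftrightarrow> v \<in> alt_word 0 ` {..<?k} \<union> alt_word 1 ` {1..<?k}"
      unfolding mem_Collect_eq weyl_less_iff[OF assms] image_iff Un_iff Bex_def
      by (metis One_nat_def atLeastLessThan_iff le_numeral_extra(3,4) lessThan_iff less_one
          linorder_not_less weyl_length_alt_word zero_le)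
  qed
  have inj: "inj_on (alt_word i) A" if "i \<le> 1" for i A
    using that by (meson alt_word_inj inj_onI)
  have disj: "alt_word 0 ` {..<?k} \<inter> alt_word 1 ` {1..<?k} = {}"
    using alt_word_inj[of 0 1] by fastforce
  have "(\<Sum>v\<in>{v. weyl_less v w}. F v) = (\<Sum>l<?k. F (alt_word 0 l)) + (\<Sum>l\<in>{1..<?k}. F (alt_word 1 l))"
    unfolding eq using disj by (subst sum.union_disjoint) (simp_all add: sum.reindex inj)
  also have "(\<Sum>l\<in>{1..<?k}. F (alt_word 1 l)) = (\<Sum>l<?k. if l = 0 then 0 else F (alt_word 1 l))"
    by (rule sum.mono_neutral_cong_left) auto
  finally show ?thesis by (simp add: sum.distrib)
qed

text \<open>The image of \<open>p \<in> {0..M}\<close> in the \<open>k\<close>-th chamber \<open>{k M..(k + 1) M}\<close>.\<close>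

definition chamber_pt :: "int \<Rightarrow> nat \<Rightarrow> int \<Rightarrow> int" where
  "chamber_pt M k p = int k * M + (if even k then p else M - p)"

lemma chamber_pt_0 [simp]: "chamber_pt M 0 p = p"
  by (simp add: chamber_pt_def)

lemma chamber_pt_Suc: "chamber_pt M (Suc k) p = M + chamber_pt M k (M - p)"
  by (simp add: chamber_pt_def algebra_simps)

lemma chamber_pt_bounds:
  "p \<in> {0..M} \<Longrightarrow> chamber_pt M k p \<in> {int k * M..int (Suc k) * M}"
  by (auto simp: chamber_pt_def algebra_simps)

text \<open>Two further letters in front of \<open>alt_word 0 k\<close> act as translation by
  \<open>2 * M\<close>, hence the induction in steps of two. A leading \<open>s\<close> reflects the
  positive chambers to the negative ones.\<close>

lemma weyl_act_alt_word:
  "weyl_act M (alt_word 0 k) p = chamber_pt M k p"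
  "weyl_act M (alt_word 1 (Suc k)) p = - chamber_pt M k p"
proof -
  show "weyl_act M (alt_word 0 k) p = chamber_pt M k p" for k
    by (induction k rule: induct_nat_012) (simp_all add: weyl_act_refl chamber_pt_def algebra_simps)
  then show "weyl_act M (alt_word 1 (Suc k)) p = - chamber_pt M k p"
    by (simp add: weyl_act_refl)
qed

section \<open>Shortest elements and the fundamental domain\<close>

lemma chamber_index_unique:
  assumes "n \<in> {int j * M..int (Suc j) * M}" "int k * M < n"  "M > 0"
  shows "k \<le> j"
proof -
  have "int k * M < int (Suc j) * M"
    using assms(1,2) by (meson atLeastAtMost_iff less_le_trans)
  then have "int k < int (Suc j)"
    using assms(3) by (meson less_imp_le mult_right_less_imp_less)
  then show ?thesis by simp
qed

text \<open>Inversion preserves length on \<open>weyl_WS\<close>, so minimality can be tested on the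
  element that carries the fundamental domain to \<open>n\<close> instead of the one that carries
  \<open>n\<close> back. The clause about ties gives the uniqueness that the definite description
  asks for.\<close>

lemma weyl_shortest_eqI:
  assumes w: "w \<in> weyl_WS" "weyl_act M (inverse w) n \<in> {0..M}"
    and min: "\<And>v. v \<in> weyl_WS \<Longrightarrow> weyl_act M (inverse v) n \<in> {0..M} \<Longrightarrow>
      weyl_length w \<le> weyl_length v \<and> (weyl_length v = weyl_length w \<longrightarrow> v = w)"
  shows "weyl_shortest M n = inverse w"
  unfolding weyl_shortest_def
proof (rule the_equality)
  have min': "weyl_length (inverse w) \<le> weyl_length v \<and> (weyl_length v = weyl_length (inverse w) \<longrightarrow> v = inverse w)"
    if "v \<in> weyl_WS" "weyl_act M v n \<in> {0..M}" for v
    using min[of "inverse v"] that w(1)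
    by (metis affine_weyl_inverse_inverse weyl_WS_inverse weyl_length_inverse)
  show "is_arg_min weyl_length (\<lambda>w. w \<in> weyl_WS \<and> weyl_act M w n \<in> {0..M}) (inverse w)"
    unfolding is_arg_min_linorder using w min' by (auto intro: weyl_WS_inverse)
  show "v = inverse w"
    if "is_arg_min weyl_length (\<lambda>w. w \<in> weyl_WS \<and> weyl_act M w n \<in> {0..M}) v" for v
    using that w min'[of v] unfolding is_arg_min_linorder
    by (meson dual_order.antisym weyl_WS_inverse)
qed

lemma inverse_act_eq_iff: "weyl_act M (inverse w) n = p \<longleftrightarrow> n = weyl_act M w p"
  by auto

lemma WS_act_cases:
  assumes "v \<in> weyl_WS"
  obtains k where "v = alt_word 0 k" "\<And>M p. weyl_act M v p = chamber_pt M k p" "weyl_length v = k"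
  | k where "v = alt_word 1 (Suc k)" "\<And>M p. weyl_act M v p = - chamber_pt M k p" "weyl_length v = Suc k"
proof -
  obtain i k where v: "i \<le> 1" "v = alt_word i k"
    using assms by (auto simp: weyl_WS_eq)
  then consider "v = alt_word 0 k" | k' where "v = alt_word 1 (Suc k')"
    by (cases k; cases i) auto
  then show ?thesis
  proof cases
    case 1
    show ?thesis
      by (rule that(1)[OF 1]) (simp_all only: 1 weyl_act_alt_word(1) weyl_length_alt_word zero_le)
  next
    case 2
    show ?thesis
      by (rule that(2)[OF 2]) (simp_all only: 2 weyl_act_alt_word(2) weyl_length_alt_word order_refl)
  qed
qed

context
  fixes M :: int
  assumes M_pos: "0 < M"
begin

text \<open>The chambers are half open: a wall point belongs to the chamber nearer the origin,
  because that one is reached by the shorter word. The point 0 is added to chamber 0 by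
  hand.\<close>

lemma weyl_shortest_nonneg:
  assumes "int k * M < n \<or> k = 0 \<and> 0 \<le> n" "n \<le> int (Suc k) * M"
  shows "weyl_shortest M n = inverse (alt_word 0 k)"
proof (rule weyl_shortest_eqI)
  define p where "p = (if even k then n - int k * M else M - (n - int k * M))"
  have "p \<in> {0..M}" using assms by (auto simp: p_def algebra_simps)
  moreover have "n = chamber_pt M k p" by (simp add: p_def chamber_pt_def)
  ultimately show "weyl_act M (inverse (alt_word 0 k)) n \<in> {0..M}"
    by (metis inverse_act_eq_iff weyl_act_alt_word(1))
next
  fix v
  assume v: "v \<in> weyl_WS" "weyl_act M (inverse v) n \<in> {0..M}"
  define p where "p = weyl_act M (inverse v) n"
  have p: "p \<in> {0..M}" "n = weyl_act M v p" using v(2) by (simp_all add: p_def)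
  show "weyl_length (alt_word 0 k) \<le> weyl_length v \<and>
    (weyl_length v = weyl_length (alt_word 0 k) \<longrightarrow> v = alt_word 0 k)"
    using v(1)
  proof (cases rule: WS_act_cases)
    case (1 j)
    then have "n \<in> {int j * M..int (Suc j) * M}" using p chamber_pt_bounds by metis
    then have "k \<le> j" using chamber_index_unique assms(1) M_pos by blast
    with 1 show ?thesis by (simp add: weyl_length_alt_word)
  next
    \<comment> \<open>A word landing on the negative side reaches \<open>n\<close> only if
      \<open>n = 0\<close>; then \<open>k = 0\<close>, and the word is longer than the
      identity.\<close>
    case (2 j)
    then have "- n \<in> {int j * M..int (Suc j) * M}" using p chamber_pt_bounds by (metis minus_minus)
    then have "n \<le> 0"
      using M_pos by (simp) (smt (verit) mult_nonneg_nonneg of_nat_0_le_iff)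
    moreover have "0 \<le> int k * M" using M_pos by simp
    ultimately have "k = 0" using assms(1) by linarith
    then have "weyl_length (alt_word 0 k) = 0" by (simp only: weyl_length_alt_word)
    with 2(3) show ?thesis by simp
  qed
qed (simp add: alt_word_in_WS)

lemma weyl_shortest_neg:
  assumes "int k * M < - n" "- n \<le> int (Suc k) * M"
  shows "weyl_shortest M n = inverse (alt_word 1 (Suc k))"
proof (rule weyl_shortest_eqI)
  define p where "p = (if even k then - n - int k * M else M - (- n - int k * M))"
  have "p \<in> {0..M}" using assms by (auto simp: p_def algebra_simps)
  moreover have "n = - chamber_pt M k p" by (simp add: p_def chamber_pt_def)
  ultimately show "weyl_act M (inverse (alt_word 1 (Suc k))) n \<in> {0..M}"
    by (metis inverse_act_eq_iff weyl_act_alt_word(2))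
next
  fix v
  assume v: "v \<in> weyl_WS" "weyl_act M (inverse v) n \<in> {0..M}"
  define p where "p = weyl_act M (inverse v) n"
  have p: "p \<in> {0..M}" "n = weyl_act M v p" using v(2) by (simp_all add: p_def)
  have len: "weyl_length (alt_word 1 (Suc k)) = Suc k" by (rule weyl_length_alt_word) simp
  show "weyl_length (alt_word 1 (Suc k)) \<le> weyl_length v \<and>
    (weyl_length v = weyl_length (alt_word 1 (Suc k)) \<longrightarrow> v = alt_word 1 (Suc k))"
    using v(1)
  proof (cases rule: WS_act_cases)
    case (1 j)
    then have "n \<in> {int j * M..int (Suc j) * M}" using p chamber_pt_bounds by metis
    then have "0 \<le> n"
      using M_pos by (simp) (smt (verit) mult_nonneg_nonneg of_nat_0_le_iff)
    moreover have "0 \<le> int k * M" using M_pos by simp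
    ultimately show ?thesis using assms(1) by linarith
  next
    case (2 j)
    then have "- n \<in> {int j * M..int (Suc j) * M}" using p chamber_pt_bounds by (metis minus_minus)
    then have "k \<le> j" using chamber_index_unique assms(1) M_pos by blast
    with 2 len show ?thesis by simp
  qed
qed (simp only: alt_word_in_WS order_refl)

text \<open>An image can return to the domain only from the base chamber or from a neighbouring one.
  In the latter case it lies on the common wall, and the reflection in that wall fixes it.\<close>

lemma fundamental_domain:
  assumes "v \<in> weyl_WS" "p \<in> {0..M}" "weyl_act M v p \<in> {0..M}"
  shows "weyl_act M v p = p"
  using assms(1)
proof (cases rule: WS_act_cases)
  case (1 k)
  have "chamber_pt M k p \<in> {int k * M..int (Suc k) * M}"
    using chamber_pt_bounds[OF assms(2)] .
  with 1 assms have "int k * M \<le> 1 * M" by simp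
  then have "k \<le> 1" using M_pos by (simp add: mult_le_cancel_right)
  with 1 assms show ?thesis by (auto simp: le_Suc_eq chamber_pt_def)
next
  case (2 k)
  have "chamber_pt M k p \<in> {int k * M..int (Suc k) * M}"
    using chamber_pt_bounds[OF assms(2)] .
  with 2 assms have "int k * M \<le> 0" by simp
  then have "k = 0" using M_pos by (simp add: mult_le_0_iff)
  with 2 assms show ?thesis by auto
qed

lemma chamber_exists:
  assumes "0 < m"
  obtains k where "int k * M < m" "m \<le> int (Suc k) * M"
proof
  \<comment> \<open>The shift by one puts a multiple of \<open>M\<close> into the lower of its two
    chambers.\<close>
  let ?k = "nat ((m - 1) div M)"
  have k: "int ?k = (m - 1) div M" using assms M_pos by (simp add: pos_imp_zdiv_nonneg_iff)
  have "(m - 1) div M * M + (m - 1) mod M = m - 1" by simp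
  moreover have "0 \<le> (m - 1) mod M" "(m - 1) mod M < M" using M_pos by simp_all
  ultimately show "int ?k * M < m" "m \<le> int (Suc ?k) * M"
    unfolding of_nat_Suc k distrib_right by linarith+
qed

lemma chamber_ptE:
  assumes "int k * M \<le> n" "n \<le> int (Suc k) * M"
  obtains p where "p \<in> {0..M}" "n = chamber_pt M k p"
proof
  define p where "p = (if even k then n - int k * M else M - (n - int k * M))"
  show "p \<in> {0..M}" using assms by (auto simp: p_def algebra_simps)
  show "n = chamber_pt M k p" by (simp add: p_def chamber_pt_def)
qed

lemma weyl_shortest_cases:
  obtains k where "0 \<le> n" "weyl_shortest M n = inverse (alt_word 0 k)"
  | k where "n < 0" "weyl_shortest M n = inverse (alt_word 1 (Suc k))"
proof -
  consider "n = 0" | "0 < n" | "0 < - n" by linarith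
  then show ?thesis
  proof cases
    case 1
    then have "weyl_shortest M n = inverse (alt_word 0 0)"
      using M_pos by (intro weyl_shortest_nonneg) auto
    with 1 that(1)[of 0] show ?thesis by simp
  next
    case 2
    then obtain k where "int k * M < n" "n \<le> int (Suc k) * M" by (rule chamber_exists)
    with 2 that(1)[of k] weyl_shortest_nonneg[of k n] show ?thesis by simp
  next
    case 3
    then obtain k where k: "int k * M < - n" "- n \<le> int (Suc k) * M" by (rule chamber_exists)
    from 3 weyl_shortest_neg[OF k] show ?thesis by (intro that(2)[of k]) linarith
  qed
qed

lemma weyl_shortest_in_WS: "weyl_shortest M n \<in> weyl_WS"
proof (cases rule: weyl_shortest_cases[of n])
  case (1 k)
  show ?thesis unfolding 1(2) by (intro weyl_WS_inverse alt_word_in_WS) simp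
next
  case (2 k)
  show ?thesis unfolding 2(2) by (intro weyl_WS_inverse alt_word_in_WS) simp
qed

lemma weyl_dom_in_domain: "weyl_dom M n \<in> {0..M}"
proof -
  consider "n = 0" | "0 < n" | "0 < - n" by linarith
  then show ?thesis
  proof cases
    case 1
    then have "weyl_shortest M n = inverse (alt_word 0 0)"
      using M_pos by (intro weyl_shortest_nonneg) auto
    then show ?thesis using 1 M_pos by (simp add: weyl_dom_def inverse_act_eq_iff)
  next
    case 2
    then obtain k where k: "int k * M < n" "n \<le> int (Suc k) * M" by (rule chamber_exists)
    then obtain p where "p \<in> {0..M}" "n = chamber_pt M k p" by (meson chamber_ptE less_imp_le)
    then show ?thesis
      using weyl_shortest_nonneg[of k n] k by (simp add: weyl_dom_def flip: weyl_act_alt_word(1))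
  next
    case 3
    then obtain k where k: "int k * M < - n" "- n \<le> int (Suc k) * M" by (rule chamber_exists)
    then obtain p where p: "p \<in> {0..M}" "- n = chamber_pt M k p" by (meson chamber_ptE less_imp_le)
    then have "n = weyl_act M (alt_word 1 (Suc k)) p" unfolding weyl_act_alt_word by simp
    then have "weyl_dom M n = p"
      unfolding weyl_dom_def weyl_shortest_neg[OF k] inverse_act_eq_iff .
    with p(1) show ?thesis by simp
  qed
qed

text \<open>The shortest element for the image, composed with \<open>v\<close>, sends
  \<open>p\<close> into the domain, so it fixes \<open>p\<close> by
  \<open>fundamental_domain\<close>. This covers wall points, whose shortest element need not be
  \<open>inverse v\<close>.\<close>

lemma weyl_dom_WS_act:
  assumes "v \<in> weyl_WS" "p \<in> {0..M}"
  shows "weyl_dom M (weyl_act M v p) = p"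
  using fundamental_domain[of "weyl_shortest M (weyl_act M v p) * v" p]
    weyl_shortest_in_WS[of "weyl_act M v p"] weyl_dom_in_domain[of "weyl_act M v p"] assms
  by (simp add: weyl_dom_def weyl_WS_mult)

text \<open>The reduced word of \<open>w_n\<close> ends in \<open>s\<close> exactly for negative
  \<open>n\<close>, and right multiplication by \<open>s\<close> shortens the word in that case and
  lengthens it otherwise.\<close>

lemma weyl_eta_shortest: "weyl_eta (weyl_shortest M n) = (if 0 \<le> n then 1 else - 1)"
proof -
  have len: "weyl_length (inverse (alt_word i k)) = k" if "i \<le> 1" for i k
    using that by (simp add: weyl_length_inverse alt_word_in_WS weyl_length_alt_word)
  show ?thesis
  proof (cases rule: weyl_shortest_cases[of n])
    case (1 k)
    have "inverse (alt_word 0 k) * weyl_s = inverse (alt_word 1 (Suc k))"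
      by (simp add: affine_weyl_inverse_mult weyl_refl_def)
    then show ?thesis using 1(1) len[of 0 k] len[of 1 "Suc k"] unfolding weyl_eta_def 1(2) by simp
  next
    case (2 k)
    have "inverse (alt_word 1 (Suc k)) * weyl_s = inverse (alt_word 0 k)"
      by (simp add: affine_weyl_inverse_mult weyl_refl_def mult.assoc)
    then show ?thesis using 2(1) len[of 0 k] len[of 1 "Suc k"] unfolding weyl_eta_def 2(2) by simp
  qed
qed

section \<open>Explicit form of X on each chamber\<close>

lemma weyl_length_shortest_nonneg:
  assumes "int k * M < n \<or> k = 0 \<and> 0 \<le> n" "n \<le> int (Suc k) * M"
  shows "weyl_length (weyl_shortest M n) = k"
  by (simp add: weyl_shortest_nonneg[OF assms] weyl_length_inverse alt_word_in_WS weyl_length_alt_word)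

lemma weyl_length_shortest_neg:
  assumes "int k * M < - n" "- n \<le> int (Suc k) * M"
  shows "weyl_length (weyl_shortest M n) = Suc k"
  by (simp only: weyl_shortest_neg[OF assms] weyl_length_inverse alt_word_in_WS weyl_length_alt_word order_refl)

text \<open>The sum over \<open>v < w\<close> in X, grouped by the length \<open>l\<close> of
  \<open>v\<close>. It depends on \<open>w\<close> only through its length \<open>k\<close>; the two
  values of \<open>f\<close> come from the word starting with \<open>s_0\<close> and the one
  starting with \<open>s_1\<close>.\<close>

definition orbit_sum :: "real \<Rightarrow> (int \<Rightarrow> complex) \<Rightarrow> nat \<Rightarrow> int \<Rightarrow> complex" where
  "orbit_sum \<tau> f k p = (\<Sum>l<k. complex_of_real \<tau> powi - (int k - int l) * a_coeff \<tau> (int k - int l) *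
     (f (chamber_pt M l p) + (if l = 0 then 0 else f (- chamber_pt M (l - 1) p))))"

lemma sum_weyl_less_orbit:
  assumes "w \<in> weyl_WS" "weyl_length w = k"
  shows "(\<Sum>v \<in> {v. weyl_less v w}. complex_of_real \<tau> powi (- (int (weyl_length w) - int (weyl_length v))) *
    a_coeff \<tau> (int (weyl_length w) - int (weyl_length v)) * f (weyl_act M v p)) = orbit_sum \<tau> f k p"
proof -
  have *: "weyl_act M (alt_word 1 l) p = - chamber_pt M (l - 1) p" if "l \<noteq> 0" for l
    using that weyl_act_alt_word(2)[of M "l - 1" p] by simp
  have len: "weyl_length (alt_word 0 l) = l" "weyl_length (alt_word 1 l) = l" for l
    by (simp_all only: weyl_length_alt_word order_refl zero_le)
  show ?thesis
    unfolding sum_weyl_less[OF assms(1)] orbit_sum_def assms(2) len weyl_act_alt_word(1)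
  proof (rule sum.cong[OF refl])
    fix l
    show "complex_of_real \<tau> powi - (int k - int l) * a_coeff \<tau> (int k - int l) * f (chamber_pt M l p) +
        (if l = 0 then 0 else complex_of_real \<tau> powi - (int k - int l) * a_coeff \<tau> (int k - int l) *
          f (weyl_act M (alt_word 1 l) p)) =
      complex_of_real \<tau> powi - (int k - int l) * a_coeff \<tau> (int k - int l) *
        (f (chamber_pt M l p) + (if l = 0 then 0 else f (- chamber_pt M (l - 1) p)))"
      by (cases "l = 0") (simp_all only: * if_True if_False add_0_right distrib_left simp_thms)
  qed
qed

text \<open>The exponent of the leading factor vanishes for two different reasons: for
  \<open>n \<le> M\<close> both lengths are 0, and for \<open>n > M\<close> the point
  \<open>u n\<close> is negative, so \<open>1 + \<eta> = 0\<close>.\<close>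

lemma X_hat_pos:
  assumes p: "p \<in> {0..M}" and n: "n = chamber_pt M k p + 1" "n \<le> int (Suc k) * M"
  shows "X_hat \<tau> M f n = f (n - 1) + orbit_sum \<tau> f k p"
proof -
  define w where "w = weyl_shortest M n"
  have b: "int k * M < n" using chamber_pt_bounds[OF p, of k] n by simp
  have w: "w \<in> weyl_WS" "weyl_length w = k"
    using weyl_shortest_in_WS weyl_length_shortest_nonneg[of k n] b n by (simp_all add: w_def)
  have "0 \<le> int k * M" using M_pos by simp
  with b have pos: "0 < n" by linarith
  have dom: "weyl_dom M (n - 1) = p"
    using weyl_dom_WS_act[of "alt_word 0 k" p] p n by (simp add: alt_word_in_WS weyl_act_alt_word)
  have exp: "(int (weyl_length (weyl_shortest M (n - 1))) - int (weyl_length w)) *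
      (1 + weyl_eta (weyl_shortest M (weyl_act M weyl_u n))) = 0"
  proof (cases "n \<le> M")
    case True
    with b have "int k * M < 1 * M" by linarith
    with M_pos have "k = 0" by (simp only: mult_less_cancel_right) auto
    moreover have "weyl_length (weyl_shortest M (n - 1)) = 0"
      using True pos by (intro weyl_length_shortest_nonneg) auto
    ultimately show ?thesis using w by simp
  next
    case False
    then show ?thesis by (simp add: weyl_eta_shortest)
  qed
  show ?thesis
    unfolding X_hat_def Let_def w_def[symmetric] exp using pos sum_weyl_less_orbit[OF w]
    by (simp add: dom)
qed

text \<open>Here \<open>u n\<close> is positive, so the exponent is twice the length difference. It
  is nonzero only when \<open>n - 1\<close> lies beyond the far wall, and then it equals 2.\<close>

lemma X_hat_neg:
  assumes p: "p \<in> {0..M}" and n: "n = - chamber_pt M k p - 1" "- n \<le> int (Suc k) * M"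
  shows "X_hat \<tau> M f n =
    (if - n = int (Suc k) * M then complex_of_real \<tau> ^ 2 else 1) * f (n - 1) - orbit_sum \<tau> f (Suc k) p"
proof -
  define w where "w = weyl_shortest M n"
  have b: "int k * M < - n" using chamber_pt_bounds[OF p, of k] n by simp
  have w: "w \<in> weyl_WS" "weyl_length w = Suc k"
    using weyl_shortest_in_WS weyl_length_shortest_neg[of k n] b n by (simp_all add: w_def)
  have "0 \<le> int k * M" using M_pos by simp
  with b have neg: "n < 0" by linarith
  have "n + 1 = weyl_act M (alt_word 1 (Suc k)) p"
    unfolding weyl_act_alt_word using n by simp
  then have dom: "weyl_dom M (n + 1) = p"
    by (simp only: weyl_dom_WS_act p alt_word_in_WS order_refl)
  have len: "weyl_length (weyl_shortest M (n - 1)) = (if - n = int (Suc k) * M then Suc (Suc k) else Suc k)"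
  proof (cases "- n = int (Suc k) * M")
    case True
    then have "weyl_length (weyl_shortest M (n - 1)) = Suc (Suc k)"
      using M_pos by (intro weyl_length_shortest_neg) (auto simp: algebra_simps)
    with True show ?thesis by simp
  next
    case False
    then have "weyl_length (weyl_shortest M (n - 1)) = Suc k"
      using b n by (intro weyl_length_shortest_neg) auto
    with False show ?thesis by simp
  qed
  have eta: "weyl_eta (weyl_shortest M (weyl_act M weyl_u n)) = 1"
    using neg M_pos by (simp add: weyl_eta_shortest)
  show ?thesis
    unfolding X_hat_def Let_def w_def[symmetric] eta len using neg sum_weyl_less_orbit[OF w]
    by (simp add: dom w)
qed

text \<open>The sum drops out because \<open>sgn 0 = 0\<close>; the square comes from crossing the
  wall at 0, with \<open>\<eta> = 1\<close> at \<open>u 0 = M\<close>.\<close>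

lemma X_hat_0: "X_hat \<tau> M f 0 = complex_of_real \<tau> ^ 2 * f (- 1)"
proof -
  have "weyl_length (weyl_shortest M 0) = 0"
    using M_pos by (intro weyl_length_shortest_nonneg) auto
  moreover have "weyl_length (weyl_shortest M (- 1)) = 1"
    using M_pos weyl_length_shortest_neg[of 0 "- 1"] by simp
  ultimately show ?thesis
    using M_pos by (simp add: X_hat_def Let_def weyl_eta_shortest)
qed

end

section \<open>Representations of the double affine Hecke algebra\<close>

lemma vector_space_cscale: "vector_space cscale"
  by unfold_locales (auto simp: cscale_def fun_eq_iff algebra_simps)

lemma in_End_C_iff:
  "F \<in> carrier End_C \<longleftrightarrow> (\<forall>f g. F (f + g) = F f + F g) \<and> (\<forall>a f. F (cscale a f) = cscale a (F f))"
  by (auto simp: End_C_def Vector_Spaces.linear_iff vector_space_cscale)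

lemma End_C_simps [simp]:
  "monoid.mult End_C = (\<circ>)" "one End_C = id" "ring.add End_C = (+)"
  by (simp_all add: End_C_def)

lemma monoid_End_C: "Group.monoid End_C"
  by (rule monoidI) (auto simp: in_End_C_iff o_assoc)

text \<open>Reduces additive statements about the free algebra to monomials.\<close>

lemma poly_mapping_single_induct [case_names zero single add]:
  fixes p :: "'a \<Rightarrow>\<^sub>0 'b :: comm_monoid_add"
  assumes "P 0" "\<And>w a. P (Poly_Mapping.single w a)" "\<And>p q. P p \<Longrightarrow> P q \<Longrightarrow> P (p + q)"
  shows "P p"
proof -
  have "P (\<Sum>w\<in>A. Poly_Mapping.single w (Poly_Mapping.lookup p w))" if "finite A" for A
    using that by induction (auto intro: assms)
  moreover have "(\<Sum>w\<in>Poly_Mapping.keys p. Poly_Mapping.single w (Poly_Mapping.lookup p w)) = p"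
    by (rule poly_mapping_eqI)
      (auto simp: lookup_sum lookup_single when_def in_keys_iff)
  ultimately show ?thesis by (metis finite_keys)
qed

lemma ring_of_type_algebra_simps [simp]:
  "carrier ring_of_type_algebra = UNIV" "monoid.mult ring_of_type_algebra = (*)"
  "one ring_of_type_algebra = 1" "ring.zero ring_of_type_algebra = 0"
  "ring.add ring_of_type_algebra = (+)"
  by (simp_all add: ring_of_type_algebra_def)

lemma ring_of_type_algebra_ring: "ring (ring_of_type_algebra :: 'a :: ring_1 ring)"
proof (rule ringI)
  show "abelian_group (ring_of_type_algebra :: 'a ring)"
  proof (rule abelian_groupI)
    fix x :: 'a
    show "\<exists>y\<in>carrier ring_of_type_algebra. y \<oplus>\<^bsub>ring_of_type_algebra\<^esub> x = \<zero>\<^bsub>ring_of_type_algebra\<^esub>"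
      by (auto intro: exI[of _ "- x"])
  qed (auto simp: algebra_simps)
  show "Group.monoid (ring_of_type_algebra :: 'a ring)"
    by (rule monoidI) (auto simp: mult.assoc)
qed (auto simp: algebra_simps)

section \<open>The quotient by the relators\<close>

lemma ideal_daha_ideal: "ideal (daha_ideal \<tau>) ring_of_type_algebra"
  unfolding daha_ideal_def by (rule ring.genideal_ideal[OF ring_of_type_algebra_ring]) simp

lemma relators_in_daha_ideal: "daha_relators \<tau> \<subseteq> daha_ideal \<tau>"
  unfolding daha_ideal_def by (rule ring.genideal_self[OF ring_of_type_algebra_ring]) simp

lemma daha_class_ring_hom: "daha_class \<tau> \<in> ring_hom ring_of_type_algebra (daha \<tau>)"
  using ideal.rcos_ring_hom[OF ideal_daha_ideal[of \<tau>]] by (simp add: daha_def daha_class_def[abs_def])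

lemma carrier_daha: "carrier (daha \<tau>) = range (daha_class \<tau>)"
  by (auto simp: daha_def FactRing_def A_RCOSETS_def' daha_class_def)

lemma daha_class_mult: "daha_class \<tau> x \<otimes>\<^bsub>daha \<tau>\<^esub> daha_class \<tau> y = daha_class \<tau> (x * y)"
  using ring_hom_mult[OF daha_class_ring_hom, of x y] by simp

lemma daha_class_add: "daha_class \<tau> x \<oplus>\<^bsub>daha \<tau>\<^esub> daha_class \<tau> y = daha_class \<tau> (x + y)"
  using ring_hom_add[OF daha_class_ring_hom, of x y] by simp

lemma one_daha: "\<one>\<^bsub>daha \<tau>\<^esub> = daha_class \<tau> 1"
  using ring_hom_one[OF daha_class_ring_hom] by simp

lemma daha_class_eq_iff: "daha_class \<tau> x = daha_class \<tau> y \<longleftrightarrow> x - y \<in> daha_ideal \<tau>"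
proof -
  interpret ideal "daha_ideal \<tau>" ring_of_type_algebra by (rule ideal_daha_ideal)
  have mem: "x \<in> daha_class \<tau> y \<longleftrightarrow> x - y \<in> daha_ideal \<tau>" for x y
    by (auto simp: daha_class_def a_r_coset_def' intro: bexI[of _ "x - y"])
  have "x \<in> daha_class \<tau> x"
    unfolding daha_class_def by (rule a_rcos_self) simp
  moreover have "daha_class \<tau> y = daha_class \<tau> x" if "x \<in> daha_class \<tau> y"
    using that unfolding daha_class_def by (rule a_repr_independence') simp
  ultimately show ?thesis using mem[of x y] by metis
qed

section \<open>Evaluating the free algebra at operators\<close>

definition daha_word :: "(daha_gen \<Rightarrow> (int \<Rightarrow> complex) \<Rightarrow> int \<Rightarrow> complex) \<Rightarrow> daha_gen list \<Rightarrow>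
    (int \<Rightarrow> complex) \<Rightarrow> int \<Rightarrow> complex" where
  "daha_word g w = foldr (\<lambda>x. (\<circ>) (g x)) w id"

definition daha_eval :: "(daha_gen \<Rightarrow> (int \<Rightarrow> complex) \<Rightarrow> int \<Rightarrow> complex) \<Rightarrow> daha_free \<Rightarrow>
    (int \<Rightarrow> complex) \<Rightarrow> int \<Rightarrow> complex" where
  "daha_eval g p = (\<lambda>f n. \<Sum>w\<in>Poly_Mapping.keys p. Poly_Mapping.lookup p w * daha_word g w f n)"

lemma daha_eval_superset:
  "finite A \<Longrightarrow> Poly_Mapping.keys p \<subseteq> A \<Longrightarrow>
    daha_eval g p f n = (\<Sum>w\<in>A. Poly_Mapping.lookup p w * daha_word g w f n)"
  unfolding daha_eval_def by (rule sum.mono_neutral_left) (auto simp: in_keys_iff)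

lemma daha_eval_add: "daha_eval g (p + q) = daha_eval g p + daha_eval g q"
proof (intro ext)
  fix f n
  let ?A = "Poly_Mapping.keys p \<union> Poly_Mapping.keys q"
  show "daha_eval g (p + q) f n = (daha_eval g p + daha_eval g q) f n"
    using keys_add[of p q]
    by (simp add: daha_eval_superset[of ?A] lookup_add distrib_right sum.distrib)
qed

lemma daha_eval_0: "daha_eval g 0 = 0"
  by (simp add: daha_eval_def fun_eq_iff)

lemma daha_eval_diff: "daha_eval g (p - q) = daha_eval g p - daha_eval g q"
  using daha_eval_add[of g "p - q" q] by simp

lemma daha_eval_single: "daha_eval g (Poly_Mapping.single w a) = cscale a \<circ> daha_word g w"
  by (auto simp: fun_eq_iff cscale_def daha_eval_superset[of "{w}"])

lemma daha_eval_const: "daha_eval g (daha_const a) = cscale a"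
  by (simp add: daha_const_def daha_eval_single daha_word_def)

lemma daha_const_1: "daha_const 1 = 1"
  by (simp add: daha_const_def zero_list_def flip: single_one)

lemma cscale_1: "cscale 1 = id"
  by (simp add: cscale_def fun_eq_iff)

lemma daha_eval_1: "daha_eval g 1 = id"
  using daha_eval_const[of g 1] by (simp add: daha_const_1 cscale_1)

lemma daha_eval_var: "daha_eval g (daha_var x) = g x"
  by (simp add: daha_var_def daha_eval_single daha_word_def cscale_1)

lemma daha_word_append: "daha_word g (v @ w) = daha_word g v \<circ> daha_word g w"
  by (induction v) (simp_all add: daha_word_def o_assoc)

context
  fixes g :: "daha_gen \<Rightarrow> (int \<Rightarrow> complex) \<Rightarrow> int \<Rightarrow> complex"
  assumes g_End: "g x \<in> carrier End_C"
begin

lemma daha_word_End: "daha_word g w \<in> carrier End_C"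
proof (induction w)
  case (Cons x w)
  then show ?case using g_End[of x] by (simp add: in_End_C_iff daha_word_def)
qed (simp add: in_End_C_iff daha_word_def)

lemma daha_eval_End: "daha_eval g p \<in> carrier End_C"
proof (induction p rule: poly_mapping_single_induct)
  case (single w a)
  then show ?case using daha_word_End[of w]
    by (simp add: daha_eval_single in_End_C_iff) (simp add: cscale_def fun_eq_iff algebra_simps)
next
  case (add p q)
  then show ?case by (simp add: daha_eval_add in_End_C_iff) (simp add: cscale_def fun_eq_iff algebra_simps)
qed (simp add: daha_eval_0 in_End_C_iff cscale_def fun_eq_iff)

text \<open>Additivity in both factors reduces this to monomials, where words concatenate. Linearity
  of the operators is what lets scalars and sums of the right factor pass through the left
  one.\<close>

lemma daha_eval_mult: "daha_eval g (p * q) = daha_eval g p \<circ> daha_eval g q"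
proof (induction p rule: poly_mapping_single_induct)
  case (single v a)
  show ?case
  proof (induction q rule: poly_mapping_single_induct)
    case zero
    have "daha_eval g (Poly_Mapping.single v a) (cscale 0 f) = cscale 0 (daha_eval g (Poly_Mapping.single v a) f)" for f
      using daha_eval_End by (simp add: in_End_C_iff)
    then show ?case by (auto simp: daha_eval_0 fun_eq_iff cscale_def zero_fun_def)
  next
    case (single w b)
    have "daha_word g v (cscale b f) = cscale b (daha_word g v f)" for f
      using daha_word_End[of v] by (simp add: in_End_C_iff)
    then show ?case
      by (simp add: mult_single daha_eval_single plus_list_def daha_word_append fun_eq_iff)
        (simp add: cscale_def)
  next
    case (add p q)
    have "daha_eval g (Poly_Mapping.single v a) (f + h) =
      daha_eval g (Poly_Mapping.single v a) f + daha_eval g (Poly_Mapping.single v a) h" for f h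
      using daha_eval_End by (simp add: in_End_C_iff)
    moreover have "(F + G) f = F f + G f" for F G :: "(int \<Rightarrow> complex) \<Rightarrow> int \<Rightarrow> complex" and f
      by (rule plus_fun_apply)
    ultimately show ?case
      by (intro ext[of "daha_eval g _"]) (simp only: distrib_left daha_eval_add add comp_apply)
  qed
next
  case (add p q)
  then show ?case by (simp add: distrib_right daha_eval_add fun_eq_iff)
qed (simp add: daha_eval_0 fun_eq_iff)

text \<open>The kernel of the evaluation is a two-sided ideal containing the relators, hence
  contains the ideal they generate.\<close>

lemma daha_eval_ideal:
  assumes rel: "\<And>r. r \<in> daha_relators \<tau> \<Longrightarrow> daha_eval g r = 0" and "p \<in> daha_ideal \<tau>"
  shows "daha_eval g p = 0"
proof -
  \<comment> \<open>For left multiples \<open>x * a\<close> of a kernel element: the composite with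
    the zero operator vanishes because a linear operator maps 0 to 0.\<close>
  have zero: "daha_eval g p 0 = 0" for p
    using daha_eval_End[of p] unfolding in_End_C_iff by (metis add_cancel_right_left)
  have "ideal {p. daha_eval g p = 0} ring_of_type_algebra"
  proof (rule idealI[OF ring_of_type_algebra_ring])
    have inv: "\<ominus>\<^bsub>ring_of_type_algebra\<^esub> a = - a" for a :: daha_free
      by (rule abelian_group.minus_equality[OF ring.is_abelian_group[OF ring_of_type_algebra_ring]]) simp_all
    show "subgroup {p. daha_eval g p = 0} (add_monoid ring_of_type_algebra)"
    proof (rule group.subgroupI)
      show "group (add_monoid (ring_of_type_algebra :: daha_free ring))"
        by (rule abelian_group.a_group[OF ring.is_abelian_group[OF ring_of_type_algebra_ring]])
      show "{p. daha_eval g p = 0} \<noteq> {}" using daha_eval_0 by blast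
      show "inv\<^bsub>add_monoid ring_of_type_algebra\<^esub> a \<in> {p. daha_eval g p = 0}"
        if "a \<in> {p. daha_eval g p = 0}" for a
        using that daha_eval_diff[of g 0 a] inv[of a] by (simp add: a_inv_def daha_eval_0)
    qed (auto simp: daha_eval_add)
  next
    fix a x
    assume "a \<in> {p. daha_eval g p = 0}"
    then show "x \<otimes>\<^bsub>ring_of_type_algebra\<^esub> a \<in> {p. daha_eval g p = 0}"
      "a \<otimes>\<^bsub>ring_of_type_algebra\<^esub> x \<in> {p. daha_eval g p = 0}"
      using zero[of x] by (auto simp: daha_eval_mult comp_def zero_fun_def)
  qed
  then have "daha_ideal \<tau> \<subseteq> {p. daha_eval g p = 0}"
    unfolding daha_ideal_def using rel
    by (intro ring.genideal_minimal[OF ring_of_type_algebra_ring]) auto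
  with assms(2) show ?thesis by blast
qed

text \<open>The evaluation factors through the quotient: two representatives of a class differ by an
  element of the ideal, so the chosen one does not matter.\<close>

lemma daha_rep_exists:
  assumes rel: "\<And>r. r \<in> daha_relators \<tau> \<Longrightarrow> daha_eval g r = 0"
  shows "\<exists>\<rho> \<in> daha_reps \<tau>. \<forall>x. \<rho> (daha_class \<tau> x) = daha_eval g x"
proof -
  define \<rho> where "\<rho> = (\<lambda>C\<in>carrier (daha \<tau>). daha_eval g (SOME x. C = daha_class \<tau> x))"
  have \<rho>: "\<rho> (daha_class \<tau> x) = daha_eval g x" for x
  proof -
    define y where "y = (SOME y. daha_class \<tau> x = daha_class \<tau> y)"
    have "daha_class \<tau> x = daha_class \<tau> y" unfolding y_def by (rule someI) (rule refl)
    then have "daha_eval g (x - y) = 0"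
      by (intro daha_eval_ideal[OF rel]) (simp_all add: daha_class_eq_iff)
    then have "daha_eval g x = daha_eval g y" by (simp add: daha_eval_diff)
    then show ?thesis by (simp add: \<rho>_def carrier_daha flip: y_def)
  qed
  have "\<rho> \<in> ring_hom (daha \<tau>) End_C"
  proof (rule ring_hom_memI)
    fix C assume "C \<in> carrier (daha \<tau>)"
    then show "\<rho> C \<in> carrier End_C" by (auto simp: carrier_daha \<rho> daha_eval_End)
  next
    fix C D assume "C \<in> carrier (daha \<tau>)" "D \<in> carrier (daha \<tau>)"
    then obtain x y where "C = daha_class \<tau> x" "D = daha_class \<tau> y" by (auto simp: carrier_daha)
    then show "\<rho> (C \<otimes>\<^bsub>daha \<tau>\<^esub> D) = \<rho> C \<otimes>\<^bsub>End_C\<^esub> \<rho> D" "\<rho> (C \<oplus>\<^bsub>daha \<tau>\<^esub> D) = \<rho> C \<oplus>\<^bsub>End_C\<^esub> \<rho> D"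
      by (simp_all add: daha_class_mult daha_class_add \<rho> daha_eval_mult daha_eval_add)
  next
    show "\<rho> \<one>\<^bsub>daha \<tau>\<^esub> = \<one>\<^bsub>End_C\<^esub>" by (simp add: one_daha \<rho> daha_eval_1)
  qed
  moreover have "\<rho> \<in> extensional (carrier (daha \<tau>))" by (simp add: \<rho>_def)
  ultimately have "\<rho> \<in> daha_reps \<tau>" by (simp add: daha_reps_def \<rho> daha_eval_const)
  with \<rho> show ?thesis by blast
qed

end

section \<open>Uniqueness of the representation\<close>

lemma daha_class_inverses:
  "daha_class \<tau> (daha_var GT * daha_var GTi) = daha_class \<tau> 1"
  "daha_class \<tau> (daha_var GTi * daha_var GT) = daha_class \<tau> 1"
  "daha_class \<tau> (daha_var GU * daha_var GUi) = daha_class \<tau> 1"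
  "daha_class \<tau> (daha_var GUi * daha_var GU) = daha_class \<tau> 1"
  "daha_class \<tau> (daha_var GX * daha_var GXi) = daha_class \<tau> 1"
  "daha_class \<tau> (daha_var GXi * daha_var GX) = daha_class \<tau> 1"
  unfolding daha_class_eq_iff
  by (rule subsetD[OF relators_in_daha_ideal],
      simp only: daha_relators_def Let_def insert_iff simp_thms)+

lemma daha_reps_eqI:
  assumes \<rho>: "\<rho>1 \<in> daha_reps \<tau>" "\<rho>2 \<in> daha_reps \<tau>"
    and eq: "\<And>x. x \<in> {GT, GU, GX} \<Longrightarrow> \<rho>1 (daha_class \<tau> (daha_var x)) = \<rho>2 (daha_class \<tau> (daha_var x))"
  shows "\<rho>1 = \<rho>2"
proof -
  have mult: "\<rho> (daha_class \<tau> (x * y)) = \<rho> (daha_class \<tau> x) \<circ> \<rho> (daha_class \<tau> y)"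
    and add: "\<rho> (daha_class \<tau> (x + y)) = \<rho> (daha_class \<tau> x) + \<rho> (daha_class \<tau> y)"
    and const: "\<rho> (daha_class \<tau> (daha_const a)) = cscale a"
    if "\<rho> \<in> daha_reps \<tau>" for \<rho> x y a
    using that ring_hom_mult[of \<rho> "daha \<tau>" End_C "daha_class \<tau> x" "daha_class \<tau> y"]
      ring_hom_add[of \<rho> "daha \<tau>" End_C "daha_class \<tau> x" "daha_class \<tau> y"]
    by (auto simp: daha_reps_def carrier_daha daha_class_mult daha_class_add)
  have one: "\<rho> (daha_class \<tau> 1) = id" if "\<rho> \<in> daha_reps \<tau>" for \<rho>
    using const[OF that, of 1] by (simp add: daha_const_1 cscale_1)
  \<comment> \<open>Uniqueness of inverses extends the agreement from the three generators to their
    formal inverses, and thus to all words.\<close>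
  have inv: "\<rho>1 (daha_class \<tau> x') = \<rho>2 (daha_class \<tau> x')"
    if "daha_class \<tau> (x * x') = daha_class \<tau> 1" "daha_class \<tau> (x' * x) = daha_class \<tau> 1"
      "\<rho>1 (daha_class \<tau> x) = \<rho>2 (daha_class \<tau> x)" for x x'
  proof -
    have "\<rho>1 (daha_class \<tau> x') = \<rho>1 (daha_class \<tau> x') \<circ> (\<rho>2 (daha_class \<tau> x) \<circ> \<rho>2 (daha_class \<tau> x'))"
      by (simp only: mult[OF \<rho>(2), symmetric] that(1) one[OF \<rho>(2)] comp_id)
    also have "\<dots> = (\<rho>1 (daha_class \<tau> x') \<circ> \<rho>1 (daha_class \<tau> x)) \<circ> \<rho>2 (daha_class \<tau> x')"
      by (simp add: that(3) o_assoc)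
    also have "\<dots> = \<rho>2 (daha_class \<tau> x')"
      by (simp only: mult[OF \<rho>(1), symmetric] that(2) one[OF \<rho>(1)] id_comp)
    finally show ?thesis .
  qed
  have var: "\<rho>1 (daha_class \<tau> (daha_var x)) = \<rho>2 (daha_class \<tau> (daha_var x))" for x
    using eq inv[OF daha_class_inverses(1,2)] inv[OF daha_class_inverses(3,4)]
      inv[OF daha_class_inverses(5,6)] by (cases x) auto
  have single_eq: "Poly_Mapping.single w a = daha_const a * Poly_Mapping.single w 1" for w and a :: complex
    by (simp add: daha_const_def mult_single plus_list_def)
  have word: "\<rho>1 (daha_class \<tau> (Poly_Mapping.single w 1)) = \<rho>2 (daha_class \<tau> (Poly_Mapping.single w 1))" for w
  proof (induction w)
    case Nil
    then show ?case using const[of _ 1] \<rho> by (simp add: daha_const_def)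
  next
    case (Cons x w)
    have "Poly_Mapping.single (x # w) (1 :: complex) = daha_var x * Poly_Mapping.single w 1"
      by (simp add: daha_var_def mult_single plus_list_def)
    then show ?case by (simp add: mult \<rho> var Cons)
  qed
  have class_eq: "\<rho>1 (daha_class \<tau> p) = \<rho>2 (daha_class \<tau> p)" for p
  proof (induction p rule: poly_mapping_single_induct)
    case zero
    have "daha_class \<tau> 0 = daha_class \<tau> (daha_const 0)" by (simp add: daha_const_def)
    then show ?case by (simp only: const \<rho>)
  next
    case (single w a)
    show ?case unfolding single_eq[of w a] by (simp only: mult const \<rho> word)
  qed (simp add: add \<rho>)
  show ?thesis
  proof (rule extensionalityI)
    show "\<rho>1 \<in> extensional (carrier (daha \<tau>))" "\<rho>2 \<in> extensional (carrier (daha \<tau>))"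
      using \<rho> by (simp_all add: daha_reps_def)
  qed (auto simp: carrier_daha class_eq)
qed

section \<open>The defining relations\<close>

lemma weyl_op_u: "weyl_op M weyl_u f n = f (M - n)"
  by (simp add: weyl_op_def)

lemma T_hat_eq:
  assumes "\<tau> \<noteq> 0"
  shows "T_hat \<tau> M f n = (if 0 \<le> n then complex_of_real \<tau> * f (- n)
    else inverse (complex_of_real \<tau>) * f (- n) + (complex_of_real \<tau> - inverse (complex_of_real \<tau>)) * f n)"
  using assms
  by (auto simp: T_hat_def cscale_def tau_sign_def weyl_op_def power_int_minus sgn_if algebra_simps)

text \<open>The recurrence applies to the summands with \<open>l \<le> k\<close>, and
  \<open>l = k + 1\<close> leaves the boundary term with \<open>c 1\<close>. Because
  \<open>c 0 = 0\<close>, the second convolution may stop before \<open>l = k\<close>.\<close>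

lemma convolution_recurrence:
  fixes c \<gamma> :: "nat \<Rightarrow> 'a :: comm_ring"
  assumes "c 0 = 0" and rec: "\<And>k. c (Suc (Suc k)) = A * c (Suc k) + B * c k"
  shows "(\<Sum>l<Suc (Suc k). c (Suc (Suc k) - l) * \<gamma> l) =
    A * (\<Sum>l<Suc k. c (Suc k - l) * \<gamma> l) + B * (\<Sum>l<k. c (k - l) * \<gamma> l) + c 1 * \<gamma> (Suc k)"
proof -
  have "(\<Sum>l<Suc k. c (Suc (Suc k) - l) * \<gamma> l) =
    (\<Sum>l<Suc k. A * (c (Suc k - l) * \<gamma> l) + B * (c (k - l) * \<gamma> l))"
  proof (rule sum.cong[OF refl])
    fix l
    assume "l \<in> {..<Suc k}"
    then show "c (Suc (Suc k) - l) * \<gamma> l = A * (c (Suc k - l) * \<gamma> l) + B * (c (k - l) * \<gamma> l)"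
      using rec[of "k - l"] by (simp add: Suc_diff_le algebra_simps)
  qed
  also have "\<dots> = A * (\<Sum>l<Suc k. c (Suc k - l) * \<gamma> l) + B * (\<Sum>l<Suc k. c (k - l) * \<gamma> l)"
    by (simp only: sum.distrib sum_distrib_left)
  also have "(\<Sum>l<Suc k. c (k - l) * \<gamma> l) = (\<Sum>l<k. c (k - l) * \<gamma> l)"
    by (simp add: assms(1))
  finally show ?thesis by simp
qed

text \<open>Here \<open>t\<close> and \<open>r\<close> stand for \<open>\<tau>\<close> and its
  inverse. The first three identities are the cases of the induction in \<open>orbit_sum_UT\<close>,
  the next two serve \<open>X_UT_neg\<close> in the first and in later chambers, and the last serves
  \<open>TUXUT\<close>. The zeros stand for empty orbit sums, so that the identities match the goals
  literally.\<close>

lemma hecke_algebra_identities: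
  fixes t r :: "'a :: comm_ring_1"
  assumes "t * r = 1"
  shows "(r\<^sup>2 - 1) * (t * a) = r * 0 + (r - t) * a"
    and "(r\<^sup>2 - 1) * ((r\<^sup>2 - 1) * (t * a)) + r\<^sup>2 * 0 + (r\<^sup>2 - 1) * (r * b + (t - r) * a + t * d) =
      r * ((r\<^sup>2 - 1) * b) + (r - t) * d"
    and "(r\<^sup>2 - 1) * (r * x + (r - t) * e) + r\<^sup>2 * (r * y + (r - t) * a) +
        (r\<^sup>2 - 1) * (r * b + (t - r) * e + t * d) =
      r * ((r\<^sup>2 - 1) * x + r\<^sup>2 * y + (r\<^sup>2 - 1) * (b + a)) + (r - t) * d"
    and "w * (t * a) = t * (w * a - (r\<^sup>2 - 1) * b) + (r - t) * (b + 0)"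
    and "w * (t * a) - (r * y + (r - t) * d) =
      t * (w * a - ((r\<^sup>2 - 1) * x + r\<^sup>2 * y + (r\<^sup>2 - 1) * (b + d))) + (r - t) * (b + x)"
    and "r * (t * a + (r - t) * b) + (t - r) * (r * b) = a"
proof -
  have [simp]: "r * t = 1" "r * (t * z) = z" for z
    using assms by (simp_all add: mult.commute flip: mult.assoc)
  show "(r\<^sup>2 - 1) * (t * a) = r * 0 + (r - t) * a"
    and "(r\<^sup>2 - 1) * ((r\<^sup>2 - 1) * (t * a)) + r\<^sup>2 * 0 + (r\<^sup>2 - 1) * (r * b + (t - r) * a + t * d) =
      r * ((r\<^sup>2 - 1) * b) + (r - t) * d"
    and "(r\<^sup>2 - 1) * (r * x + (r - t) * e) + r\<^sup>2 * (r * y + (r - t) * a) +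
        (r\<^sup>2 - 1) * (r * b + (t - r) * e + t * d) =
      r * ((r\<^sup>2 - 1) * x + r\<^sup>2 * y + (r\<^sup>2 - 1) * (b + a)) + (r - t) * d"
    and "w * (t * a) = t * (w * a - (r\<^sup>2 - 1) * b) + (r - t) * (b + 0)"
    and "w * (t * a) - (r * y + (r - t) * d) =
      t * (w * a - ((r\<^sup>2 - 1) * x + r\<^sup>2 * y + (r\<^sup>2 - 1) * (b + d))) + (r - t) * (b + x)"
    and "r * (t * a + (r - t) * b) + (t - r) * (r * b) = a"
    by (simp_all add: algebra_simps power2_eq_square)
qed

section \<open>Recurrence for the orbit sums\<close>

locale daha_operators =
  fixes \<tau> :: real and M :: int
  assumes \<tau>_pos: "0 < \<tau>" and M_pos: "0 < M"
begin

abbreviation t where "t \<equiv> complex_of_real \<tau>"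
abbreviation opT where "opT \<equiv> T_hat \<tau> M"
abbreviation opU where "opU \<equiv> weyl_op M weyl_u"
abbreviation opX where "opX \<equiv> X_hat \<tau> M"

lemma t_times_inverse: "t * inverse t = 1" using \<tau>_pos by simp

definition orbit_coeff where "orbit_coeff k = t powi (- int k) * a_coeff \<tau> (int k)"

text \<open>With \<open>q = \<tau>^-2\<close> the coefficient becomes a combination of the geometric
  sequences \<open>q^k\<close> and \<open>(-1)^k\<close>.\<close>

lemma orbit_coeff_closed: "orbit_coeff k = (inverse t ^ 2 - 1) / (inverse t ^ 2 + 1) * ((inverse t ^ 2) ^ k - (- 1) ^ k)"
proof -
  have inv: "inverse t ^ 2 * t ^ 2 = 1"
    using \<tau>_pos by (simp flip: power_mult_distrib)
  have "(inverse t ^ 2 - 1) / (inverse t ^ 2 + 1) =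
      (inverse t ^ 2 * (1 - t ^ 2)) / (inverse t ^ 2 * (1 + t ^ 2))"
    using inv by (simp only: distrib_left right_diff_distrib mult_1_right add.commute)
  also have "\<dots> = (1 - t\<^sup>2) / (1 + t\<^sup>2)"
    using \<tau>_pos by (subst mult_divide_mult_cancel_left) (auto simp: add.commute)
  finally have "(1 - t\<^sup>2) / (1 + t\<^sup>2) = (inverse t ^ 2 - 1) / (inverse t ^ 2 + 1)" ..
  moreover have "t powi (- int k) * (t powi (- int k) + (- 1) powi (int k + 1) * t powi int k) =
    (inverse t ^ 2) ^ k - (- 1) ^ k"
  proof -
    have "t powi (- int k) = inverse t ^ k" by (simp add: power_int_minus power_inverse)
    moreover have "(- 1) powi (int k + 1) = - ((- 1 :: complex) ^ k)"
      by (simp add: power_int_add)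
    moreover have "inverse t ^ k * t ^ k = 1" using \<tau>_pos by (simp flip: power_mult_distrib)
    ultimately show ?thesis
      by (simp add: algebra_simps power_mult_distrib power2_eq_square)
  qed
  ultimately show ?thesis by (simp add: orbit_coeff_def a_coeff_def mult.assoc mult.left_commute)
qed

lemma inverse_t_square_plus_one: "inverse t ^ 2 + 1 \<noteq> 0"
proof -
  have "0 < inverse \<tau> ^ 2 + 1" by (simp add: add_nonneg_pos)
  moreover have "inverse t ^ 2 + 1 = complex_of_real (inverse \<tau> ^ 2 + 1)" by simp
  ultimately show ?thesis by (metis less_irrefl of_real_eq_0_iff)
qed

lemma orbit_coeff_0: "orbit_coeff 0 = 0"
  by (simp add: orbit_coeff_closed)

lemma orbit_coeff_1: "orbit_coeff 1 = inverse t ^ 2 - 1"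
  using inverse_t_square_plus_one by (simp add: orbit_coeff_closed)

text \<open>Both \<open>q = \<tau>^-2\<close> and -1 are roots of
  \<open>x^2 = (q - 1) x + q\<close>.\<close>

lemma orbit_coeff_rec: "orbit_coeff (Suc (Suc k)) = (inverse t ^ 2 - 1) * orbit_coeff (Suc k) + inverse t ^ 2 * orbit_coeff k"
proof -
  have "K * (q * (q * x) - - 1 * (- 1 * y)) = (q - 1) * (K * (q * x - - 1 * y)) + q * (K * (x - y))"
    for K q x y :: complex
    by (simp add: algebra_simps)
  then show ?thesis unfolding orbit_coeff_closed power_Suc .
qed

abbreviation orbS where "orbS \<equiv> orbit_sum M \<tau>"

definition orbit_term :: "(int \<Rightarrow> complex) \<Rightarrow> int \<Rightarrow> nat \<Rightarrow> complex" where
  "orbit_term f p l = f (chamber_pt M l p) + (if l = 0 then 0 else f (- chamber_pt M (l - 1) p))"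

lemma orbit_sum_eq: "orbS f k p = (\<Sum>l<k. orbit_coeff (k - l) * orbit_term f p l)"
  unfolding orbit_sum_def[OF M_pos]
  by (rule sum.cong) (simp_all add: orbit_coeff_def orbit_term_def of_nat_diff)

lemma orbit_sum_0: "orbS f 0 p = 0"
  by (simp add: orbit_sum_eq)

lemma orbit_sum_1: "orbS f (Suc 0) p = (inverse t ^ 2 - 1) * f p"
  using orbit_coeff_1 by (simp add: orbit_sum_eq orbit_term_def)

lemma orbit_sum_rec: "orbS f (Suc (Suc k)) p = (inverse t ^ 2 - 1) * orbS f (Suc k) p + inverse t ^ 2 * orbS f k p
    + (inverse t ^ 2 - 1) * (f (chamber_pt M (Suc k) p) + f (- chamber_pt M k p))"
  unfolding orbit_sum_eq using convolution_recurrence[of orbit_coeff, OF orbit_coeff_0 orbit_coeff_rec, of k "orbit_term f p"] orbit_coeff_1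
  by (simp add: orbit_term_def)

text \<open>The point \<open>M - p\<close> in chamber \<open>l + 1\<close> is \<open>M + x\<close>,
  where \<open>x\<close> is the point \<open>p\<close> in chamber \<open>l\<close>, and
  \<open>U\<close> reads it at \<open>-x\<close>. So \<open>U T\<close> moves the orbit by one
  chamber while \<open>T\<close> mixes the values at \<open>x\<close> and \<open>-x\<close>; the
  term with \<open>f (- chamber_pt M k p)\<close> is what remains at the end of the sum.\<close>

lemma orbit_sum_UT:
  assumes p: "p \<in> {0..M}"
  shows "orbS (opU (opT f)) (Suc k) (M - p) = inverse t * orbS f k p + (inverse t - t) * f (- chamber_pt M k p)"
proof -
  have nn: "0 \<le> chamber_pt M l p" for l
    using chamber_pt_bounds[OF p, of l] M_pos
    by simp (smt (verit) mult_nonneg_nonneg of_nat_0_le_iff)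
  have T_pos: "opT f (chamber_pt M l p) = t * f (- chamber_pt M l p)" for l
    using \<tau>_pos nn[of l] by (simp add: T_hat_eq)
  \<comment> \<open>This holds for the point 0 too, where both branches of \<open>T\<close> give
    \<open>t * f 0\<close>.\<close>
  have T_neg: "opT f (- chamber_pt M l p) =
      inverse t * f (chamber_pt M l p) + (t - inverse t) * f (- chamber_pt M l p)" for l
    using \<tau>_pos nn[of l] by (auto simp: T_hat_eq algebra_simps)
  have UT: "opU (opT f) (M + x) = opT f (- x)" "opU (opT f) (- x) = opT f (M + x)" for x
    by (simp_all add: weyl_op_u)
  have "opU (opT f) (M - p) = t * f (- p)"
    using T_pos[of 0] by (simp add: weyl_op_u)
  note g_0 = this
  have g_pos: "opU (opT f) (chamber_pt M (Suc l) (M - p)) =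
      inverse t * f (chamber_pt M l p) + (t - inverse t) * f (- chamber_pt M l p)" for l
    by (simp add: chamber_pt_Suc UT T_neg)
  have g_neg: "opU (opT f) (- chamber_pt M l (M - p)) = t * f (- chamber_pt M (Suc l) p)" for l
    unfolding UT chamber_pt_Suc[symmetric] T_pos ..
  show ?thesis
  \<comment> \<open>The recurrence is of second order, so two initial values are needed.\<close>
  proof (induction k rule: induct_nat_012)
    case 0
    show ?case
      unfolding orbit_sum_1 orbit_sum_0 g_0 chamber_pt_0 by (rule hecke_algebra_identities(1)[OF t_times_inverse])
  next
    case 1
    show ?case
      unfolding orbit_sum_1 orbit_sum_rec orbit_sum_0 g_0 g_pos g_neg[of 0, unfolded chamber_pt_0] chamber_pt_0
      by (rule hecke_algebra_identities(2)[OF t_times_inverse])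
  next
    case (ge2 k)
    show ?case
      unfolding orbit_sum_rec[of "opU (opT f)" "Suc k"] ge2 orbit_sum_rec[of f k] g_pos g_neg
      by (rule hecke_algebra_identities(3)[OF t_times_inverse])
  qed
qed

section \<open>The relation TUXUT = X\<close>

lemma U_U: "opU (opU f) = f"
  by (simp add: weyl_op_u fun_eq_iff)

text \<open>For \<open>n > 0\<close>, passing from \<open>n\<close> to \<open>M + n\<close> raises
  the chamber index by one. The multiples of \<open>f (- (n - 1))\<close> coming from
  \<open>T\<close> and from \<open>orbit_sum_UT\<close> cancel.\<close>

lemma X_UT_nonneg:
  assumes "0 \<le> n"
  shows "opX (opU (opT f)) (M + n) = inverse t * opX f n"
proof (cases "n = 0")
  case True
  have "opX (opU (opT f)) (M + n) = opU (opT f) (M - 1)"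
    using X_hat_pos[OF M_pos, of "M - 1" "M + n" 0] M_pos orbit_sum_0 True by simp
  also have "\<dots> = t * f (- 1)" using \<tau>_pos by (simp add: weyl_op_u T_hat_eq)
  finally show ?thesis using True \<tau>_pos by (simp add: X_hat_0[OF M_pos] power2_eq_square)
next
  case False
  with assms have "0 < n" by simp
  then obtain k where k: "int k * M < n" "n \<le> int (Suc k) * M" using chamber_exists[OF M_pos] by blast
  then obtain p where p: "p \<in> {0..M}" "n - 1 = chamber_pt M k p"
    using chamber_ptE[OF M_pos, of k "n - 1"] by (smt (verit))
  have n: "n = chamber_pt M k p + 1" using p(2) by simp
  have p': "M - p \<in> {0..M}" using p(1) by auto
  have X_n: "opX f n = f (n - 1) + orbS f k p"
    by (rule X_hat_pos[OF M_pos p(1) n k(2)])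
  have "opX (opU (opT f)) (M + n) = opU (opT f) (M + n - 1) + orbS (opU (opT f)) (Suc k) (M - p)"
    by (rule X_hat_pos[OF M_pos p']) (use k n in \<open>simp_all add: chamber_pt_Suc algebra_simps\<close>)
  also have "opU (opT f) (M + n - 1) = opT f (- (n - 1))" by (simp add: weyl_op_u)
  also have "\<dots> = inverse t * f (n - 1) + (t - inverse t) * f (- (n - 1))"
    using \<open>0 < n\<close> \<tau>_pos by (cases "n = 1") (simp_all add: T_hat_eq algebra_simps)
  finally show ?thesis unfolding orbit_sum_UT[OF p(1)] p(2)[symmetric] X_n by (simp add: algebra_simps)
qed

text \<open>Passing from \<open>n\<close> to \<open>M + n\<close> lowers the chamber index by one.
  Expanding the longer orbit sum in \<open>X f n\<close> by its recurrence produces the sum of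
  length \<open>k\<close>, which is the one contained in \<open>X f (- n)\<close>.\<close>

lemma X_UT_neg:
  assumes "n < 0"
  shows "opX (opU (opT f)) (M + n) = t * opX f n + (inverse t - t) * opX f (- n)"
proof -
  have "0 < - n" using assms by simp
  then obtain k where k: "int k * M < - n" "- n \<le> int (Suc k) * M" using chamber_exists[OF M_pos] by blast
  then obtain p where p: "p \<in> {0..M}" "- n - 1 = chamber_pt M k p"
    using chamber_ptE[OF M_pos, of k "- n - 1"] by (smt (verit))
  have n: "- n = chamber_pt M k p + 1" "n = - chamber_pt M k p - 1" using p(2) by simp_all
  have p': "M - p \<in> {0..M}" using p(1) by auto
  have X_minus: "opX f (- n) = f (- n - 1) + orbS f k p"
    by (rule X_hat_pos[OF M_pos p(1) n(1) k(2)])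
  have X_n: "opX f n = (if - n = int (Suc k) * M then t ^ 2 else 1) * f (n - 1) - orbS f (Suc k) p"
    by (rule X_hat_neg[OF M_pos p(1) n(2) k(2)])
  have UT: "opU (opT f) (M + n - 1) = t * f (n - 1)"
    using assms \<tau>_pos by (simp add: weyl_op_u T_hat_eq)
  show ?thesis
  proof (cases k)
    case 0
    have p_eq: "p = - n - 1" using p(2) 0 by simp
    have "opX (opU (opT f)) (M + n) = (if - n = M then t ^ 2 else 1) * opU (opT f) (M + n - 1)"
    \<comment> \<open>From the first negative chamber \<open>M + n\<close> lands in
      \<open>{0..M - 1}\<close>; the wall factor \<open>t^2\<close> of \<open>X f n\<close>
      reappears at the point 0 through \<open>X_hat_0\<close>.\<close>
    proof (cases "- n = M")
      case True
      then have "M + n = 0" by simp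
      with True show ?thesis by (simp only: X_hat_0[OF M_pos] if_True) simp
    next
      case False
      with X_hat_pos[OF M_pos, of "M + n - 1" "M + n" 0 \<tau> "opU (opT f)"] k assms 0 show ?thesis
        by (simp add: orbit_sum_0)
    qed
    then have "opX (opU (opT f)) (M + n) =
        (if - n = int (Suc 0) * M then t ^ 2 else 1) * opU (opT f) (M + n - 1)"
      by simp
    then show ?thesis
      unfolding UT X_minus X_n 0 orbit_sum_1 orbit_sum_0 p_eq
      by (rule trans) (rule hecke_algebra_identities(4)[OF t_times_inverse])
  next
    case (Suc j)
    have "opX (opU (opT f)) (M + n) = (if - (M + n) = int (Suc j) * M then t ^ 2 else 1) * opU (opT f) (M + n - 1)
        - orbS (opU (opT f)) (Suc j) (M - p)"
      by (rule X_hat_neg[OF M_pos p'])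
        (use k n Suc in \<open>simp_all add: chamber_pt_Suc algebra_simps\<close>)
    also have "- (M + n) = int (Suc j) * M \<longleftrightarrow> - n = int (Suc k) * M"
      using Suc by (auto simp: algebra_simps)
    finally show ?thesis
      unfolding UT orbit_sum_UT[OF p(1)] X_minus X_n p(2)
      unfolding Suc orbit_sum_rec by (rule trans) (rule hecke_algebra_identities(5)[OF t_times_inverse])
  qed
qed

lemma T_quadratic: "opT (opT f) n = (t - inverse t) * opT f n + f n"
  using \<tau>_pos by (auto simp: T_hat_eq algebra_simps)

text \<open>The inverse of T read off from \<open>T^2 = (t - inverse t) T + 1\<close>.\<close>

definition opT_inv where "opT_inv f = opT f - cscale (t - inverse t) f"

lemma T_T_inv: "opT (opT_inv f) = f"
  using \<tau>_pos by (auto simp: fun_eq_iff opT_inv_def T_hat_eq cscale_def algebra_simps)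

lemma T_inv_T: "opT_inv (opT f) = f"
  by (simp add: fun_eq_iff opT_inv_def T_quadratic cscale_def)

text \<open>After expanding the outer \<open>T U\<close>, the values at \<open>M + n\<close> and
  \<open>M - n\<close> are those of the two preceding lemmas; for negative \<open>n\<close> the
  contributions of \<open>X f (- n)\<close> cancel.\<close>

lemma TUXUT: "opT (opU (opX (opU (opT f)))) = opX f"
proof
  fix n
  show "opT (opU (opX (opU (opT f)))) n = opX f n"
  proof (cases "0 \<le> n")
    case True
    then show ?thesis using \<tau>_pos by (simp add: T_hat_eq weyl_op_u X_UT_nonneg)
  next
    case False
    then have "opT (opU (opX (opU (opT f)))) n =
      inverse t * opX (opU (opT f)) (M + n) + (t - inverse t) * opX (opU (opT f)) (M + (- n))"
      using \<tau>_pos by (simp add: T_hat_eq[of \<tau>] weyl_op_u)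
    then show ?thesis
      using False X_UT_neg[of n f] X_UT_nonneg[of "- n" f] hecke_algebra_identities(6)[OF t_times_inverse]
      by (simp only: not_le)
  qed
qed

section \<open>The relation XUXU = 1\<close>

lemma T_inv_XU: "opT_inv (opX (opU h)) = opU (opX (opU (opT (opU h))))"
  using TUXUT[of "opU h"] T_inv_T by metis

text \<open>Inserting \<open>T T^-1\<close> before the second factor makes
  \<open>X_UT_nonneg\<close> applicable, and \<open>T_inv_XU\<close> turns the result into
  \<open>X U X U\<close> at \<open>n\<close>, applied to \<open>T U h\<close>. The hypothesis must
  therefore hold for every function, not just for \<open>h\<close>.\<close>

lemma XUXU_step_pos:
  assumes "0 \<le> n" "\<And>h. opX (opU (opX (opU h))) n = h n"
  shows "opX (opU (opX (opU h))) (M + n) = h (M + n)"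
proof -
  have "opX (opU (opX (opU h))) (M + n) = inverse t * opX (opT_inv (opX (opU h))) n"
    using X_UT_nonneg[OF assms(1), of "opT_inv (opX (opU h))"] by (simp add: T_T_inv)
  also have "\<dots> = inverse t * opT (opU h) n"
    unfolding T_inv_XU by (simp add: assms(2))
  also have "\<dots> = h (M + n)"
    using assms(1) \<tau>_pos by (simp add: T_hat_eq weyl_op_u)
  finally show ?thesis .
qed

lemma XUXU_step_neg:
  assumes "n < 0" "\<And>h. opX (opU (opX (opU h))) (M + n) = h (M + n)" "\<And>h. opX (opU (opX (opU h))) (- n) = h (- n)"
  shows "opX (opU (opX (opU h))) n = h n"
proof -
  \<comment> \<open>Chosen with \<open>T U h' = h\<close>: the value of \<open>X U X U h'\<close> at
    \<open>M + n\<close> then involves \<open>X U X U h\<close> at \<open>n\<close> and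
    \<open>- n\<close>, and the equation can be solved for the value at \<open>n\<close>.\<close>
  define h' where "h' = opU (opT_inv h)"
  have TU: "opT (opU h') = h" by (simp add: h'_def U_U T_T_inv)
  have "h' (M + n) = opX (opU (opT (opT_inv (opX (opU h'))))) (M + n)" by (simp add: T_T_inv assms(2))
  also have "\<dots> = t * opX (opU (opX (opU h))) n + (inverse t - t) * opX (opU (opX (opU h))) (- n)"
    unfolding X_UT_neg[OF assms(1)] T_inv_XU TU ..
  finally have "h' (M + n) = t * opX (opU (opX (opU h))) n + (inverse t - t) * h (- n)"
    by (simp add: assms(3))
  moreover have "h' (M + n) = t * h n - (t - inverse t) * h (- n)"
    using assms(1) \<tau>_pos by (simp add: h'_def weyl_op_u opT_inv_def T_hat_eq cscale_def)
  ultimately have "t * opX (opU (opX (opU h))) n + (inverse t - t) * h (- n) =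
      t * h n - (t - inverse t) * h (- n)" by simp
  then have "t * opX (opU (opX (opU h))) n = t * h n" by (simp only: left_diff_distrib) simp
  then show ?thesis using \<tau>_pos by simp
qed

lemma X_pos_base: "n \<in> {1..M} \<Longrightarrow> opX f n = f (n - 1)"
  using X_hat_pos[OF M_pos, of "n - 1" n 0] by (simp add: orbit_sum_0)

lemma XUXU_nonneg: "0 \<le> n \<Longrightarrow> opX (opU (opX (opU h))) n = h n"
proof (induction "nat n" arbitrary: n h rule: less_induct)
  case less
  consider "n = 0" | "n \<in> {1..M}" | "M < n"
    using less.prems unfolding atLeastAtMost_iff by linarith
  then show ?case
  proof cases
    case 1
    \<comment> \<open>At 0 the outer X contributes \<open>t^2\<close> and looks at
      \<open>M + 1\<close>, just beyond the upper wall; the one-term orbit sum there supplies the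
      compensating \<open>\<tau>^-2\<close>.\<close>
    have "opX (opU h) (M + 1) = opU h M + orbS (opU h) 1 M"
      using X_hat_pos[OF M_pos, of M "M + 1" 1 \<tau> "opU h"] M_pos by (simp add: chamber_pt_def)
    also have "\<dots> = inverse t ^ 2 * h 0"
      unfolding One_nat_def orbit_sum_1 weyl_op_u by (simp add: left_diff_distrib)
    finally have "t ^ 2 * opX (opU h) (M + 1) = (t * inverse t) ^ 2 * h 0"
      by (simp only: power_mult_distrib mult.assoc)
    then show ?thesis
      unfolding 1 X_hat_0[OF M_pos] weyl_op_u t_times_inverse by simp
  next
    \<comment> \<open>In the base chamber X is a pure shift, and \<open>U\<close> reverses its
      direction.\<close>
    case 2
    then have "M - (n - 1) \<in> {1..M}" by auto
    then show ?thesis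
      unfolding X_pos_base[OF 2] weyl_op_u X_pos_base[OF \<open>M - (n - 1) \<in> {1..M}\<close>] by simp
  next
    case 3
    then have n: "nat (n - M) < nat n" "0 \<le> n - M" using M_pos by auto
    have "opX (opU (opX (opU h))) (M + (n - M)) = h (M + (n - M))"
      by (rule XUXU_step_pos[OF n(2) less.hyps[OF n]])
    then show ?thesis by simp
  qed
qed

lemma XUXU: "opX (opU (opX (opU h))) = h"
proof
  fix n
  show "opX (opU (opX (opU h))) n = h n"
  \<comment> \<open>For negative \<open>n\<close> the step needs the values at \<open>M + n\<close>,
    of smaller measure, and at \<open>- n\<close>, which is nonnegative.\<close>
  proof (induction "nat (- n)" arbitrary: n h rule: less_induct)
    case less
    show ?case
    proof (cases "0 \<le> n")
      case False
      then have n: "n < 0" "nat (- (M + n)) < nat (- n)" "0 \<le> - n" using M_pos by auto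
      show ?thesis by (rule XUXU_step_neg[OF n(1) less[OF n(2)] XUXU_nonneg[OF n(3)]])
    qed (rule XUXU_nonneg)
  qed
qed

section \<open>Assembling the representation\<close>

lemma operators_End_C: "opT \<in> carrier End_C" "opU \<in> carrier End_C" "opX \<in> carrier End_C"
proof -
  show "opT \<in> carrier End_C"
    by (simp add: in_End_C_iff fun_eq_iff T_hat_def cscale_def tau_sign_def weyl_op_def algebra_simps)
  show "opU \<in> carrier End_C"
    by (simp add: in_End_C_iff fun_eq_iff cscale_def weyl_op_def)
  show "opX \<in> carrier End_C"
    by (simp add: in_End_C_iff fun_eq_iff cscale_def X_hat_def Let_def sum.distrib sum_distrib_left
        distrib_left distrib_right mult_ac)
qed

lemma T_inv_End_C: "opT_inv \<in> carrier End_C"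
  using operators_End_C(1)
  by (simp add: in_End_C_iff opT_inv_def) (simp add: fun_eq_iff cscale_def algebra_simps)

lemma UXU_End_C: "opU \<circ> opX \<circ> opU \<in> carrier End_C"
  using operators_End_C(2,3) by (simp add: in_End_C_iff)

lemma UXUX: "opU (opX (opU (opX h))) = h"
  using XUXU[of "opU h"] by (simp add: U_U)

lemma quadratic_relation: "(opT - cscale t) \<circ> (opT + cscale (inverse t)) = 0"
proof (intro ext)
  fix f n
  have "opT (opT f + cscale (inverse t) f) = opT (opT f) + cscale (inverse t) (opT f)"
    using operators_End_C(1) unfolding in_End_C_iff by metis
  then show "((opT - cscale t) \<circ> (opT + cscale (inverse t))) f n = 0 f n"
    using \<tau>_pos by (simp add: T_quadratic) (simp add: cscale_def algebra_simps)
qed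

lemma UXU_eq: "opU \<circ> opX \<circ> opU = opT_inv \<circ> opX \<circ> opT_inv"
proof
  fix f
  have "opT (opU (opX (opU f))) = opX (opT_inv f)" using TUXUT[of "opT_inv f"] by (simp add: T_T_inv)
  then show "(opU \<circ> opX \<circ> opU) f = (opT_inv \<circ> opX \<circ> opT_inv) f" by (metis T_inv_T comp_apply)
qed

text \<open>The formal inverse of X is sent to \<open>U X U\<close>, so the relator
  \<open>u * x * u - x'\<close> vanishes at once. That this operator inverts X is
  \<open>XUXU\<close> and \<open>UXUX\<close>, and the last relator is
  \<open>UXU_eq\<close>.\<close>

definition generator_op where
  "generator_op = case_daha_gen opT opU opX opT_inv opU (opU \<circ> opX \<circ> opU)"

lemma generator_op_End_C: "generator_op x \<in> carrier End_C"
  using operators_End_C T_inv_End_C UXU_End_C by (cases x) (simp_all add: generator_op_def)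

lemma operator_inverses:
  "opT \<circ> opT_inv = id" "opT_inv \<circ> opT = id" "opU \<circ> opU = id"
  "opX \<circ> (opU \<circ> opX \<circ> opU) = id" "opU \<circ> opX \<circ> opU \<circ> opX = id"
  by (rule ext, simp only: comp_apply id_apply T_T_inv T_inv_T U_U XUXU UXUX)+

lemma generator_op_relators:
  assumes "r \<in> daha_relators \<tau>"
  shows "daha_eval generator_op r = 0"
proof -
  note eval = daha_eval_mult[OF generator_op_End_C] daha_eval_diff daha_eval_add daha_eval_1
    daha_eval_var daha_eval_const power2_eq_square
  note gen = generator_op_def daha_gen.case
  show ?thesis
    using assms unfolding daha_relators_def Let_def insert_iff empty_iff
    by (elim disjE FalseE; hypsubst; simp only: eval)
      (simp_all only: gen operator_inverses quadratic_relation UXU_eq[symmetric] diff_self)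
qed

lemma inv_End_C_eq:
  assumes "F \<in> carrier End_C" "G \<in> carrier End_C" "F \<circ> G = id" "G \<circ> F = id"
  shows "F \<in> Units End_C" "inv\<^bsub>End_C\<^esub> F = G"
  using assms monoid.inv_char[OF monoid_End_C, of F G] by (auto simp: Units_def)

end

theorem theorem3p1:
  fixes \<tau> :: real and M :: int
  assumes "0 < \<tau>" and "\<tau> < 1" and "1 < M"
  shows "(\<exists>!\<rho>. \<rho> \<in> daha_reps \<tau> \<and>
            \<rho> (daha_class \<tau> (daha_var GT)) = T_hat \<tau> M \<and>
            \<rho> (daha_class \<tau> (daha_var GU)) = weyl_op M weyl_u \<and>
            \<rho> (daha_class \<tau> (daha_var GX)) = X_hat \<tau> M) \<and>
    T_hat \<tau> M \<in> Units End_C \<and> weyl_op M weyl_u \<in> Units End_C \<and> X_hat \<tau> M \<in> Units End_C \<and>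
    weyl_op M weyl_u \<circ> weyl_op M weyl_u = id \<and>
    (T_hat \<tau> M - cscale (complex_of_real \<tau>)) \<circ>
      (T_hat \<tau> M + cscale (inverse (complex_of_real \<tau>))) = 0 \<and>
    weyl_op M weyl_u \<circ> X_hat \<tau> M \<circ> weyl_op M weyl_u = inv\<^bsub>End_C\<^esub> (X_hat \<tau> M) \<and>
    inv\<^bsub>End_C\<^esub> (X_hat \<tau> M) = inv\<^bsub>End_C\<^esub> (T_hat \<tau> M) \<circ> X_hat \<tau> M \<circ> inv\<^bsub>End_C\<^esub> (T_hat \<tau> M)"
proof -
  interpret daha_operators \<tau> M by unfold_locales (use assms in auto)
  obtain \<rho> where \<rho>: "\<rho> \<in> daha_reps \<tau>"
    and eval: "\<And>x. \<rho> (daha_class \<tau> x) = daha_eval generator_op x"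
    using daha_rep_exists[OF generator_op_End_C generator_op_relators] by blast
  have "\<exists>!\<rho>. \<rho> \<in> daha_reps \<tau> \<and> \<rho> (daha_class \<tau> (daha_var GT)) = opT \<and>
      \<rho> (daha_class \<tau> (daha_var GU)) = opU \<and> \<rho> (daha_class \<tau> (daha_var GX)) = opX"
  proof (rule ex1I[of _ \<rho>])
    show "\<rho> \<in> daha_reps \<tau> \<and> \<rho> (daha_class \<tau> (daha_var GT)) = opT \<and>
        \<rho> (daha_class \<tau> (daha_var GU)) = opU \<and> \<rho> (daha_class \<tau> (daha_var GX)) = opX"
      using \<rho> by (simp add: eval daha_eval_var generator_op_def)
    then show "\<rho>' = \<rho>" if "\<rho>' \<in> daha_reps \<tau> \<and> \<rho>' (daha_class \<tau> (daha_var GT)) = opT \<and>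
        \<rho>' (daha_class \<tau> (daha_var GU)) = opU \<and> \<rho>' (daha_class \<tau> (daha_var GX)) = opX" for \<rho>'
      using that by (intro daha_reps_eqI) auto
  qed
  moreover note inv_T = inv_End_C_eq[OF operators_End_C(1) T_inv_End_C operator_inverses(1,2)]
    and inv_U = inv_End_C_eq[OF operators_End_C(2,2) operator_inverses(3,3)]
    and inv_X = inv_End_C_eq[OF operators_End_C(3) UXU_End_C operator_inverses(4,5)]
  ultimately show ?thesis
    using operator_inverses(3) quadratic_relation UXU_eq by (simp only: inv_T inv_X inv_U simp_thms)
qed

end
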